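(* Let $G$ be a finite group, let $S$ be a finite $G$-set and let $i$ be a positive integer. If $i\le |S|$, then $$\lambda^i(S)=(-1)^i\sum_{\mu\vdash i}(-1)^{\ell(\mu)}\binom{\ell(\mu)}{\alpha(\mu)}\,[\mathcal{P}_\mu(S)]\in\mathcal{B}(G),$$ and if $i>|S|$, then $\lambda^i(S)=0$.
   Context: $\mathcal{B}(G)$ denotes the Burnside ring of the finite group $G$: the Grothendieck ring of finite $G$-sets, with addition given by disjoint union and multiplication by Cartesian product; $[S]$ is the class of the $G$-set $S$. For a function $f$ on $\mathcal{B}(G)$ write $f(S)$ for $f([S])$. $\lambda$-structure on $\mathcal{B}(G)$: for a finite $G$-set $S$ let $\sigma^n(S)=[S^n/\Sigma_n]$ be the class of the $n$th symmetric power of $S$ (with $\sigma^0(S)=1$), $\Sigma_n$ being the symmetric group on $n$ letters permuting the factors. This extends uniquely to $\mathcal{B}(G)$ by requiring that $\sigma_t(x):=\sum_{i\ge 0}\sigma^i(x)t^i\in\mathcal{B}(G)[[t]]$ satisfies $\sigma_t(x+y)=\sigma_t(x)\sigma_t(y)$. The operations $\lambda^i$ on $\mathcal{B}(G)$ are defined as the opposite structure: with $\lambda_t(x):=\sum_{i\ge0}\lambda^i(x)t^i$, one requires $\sigma_t(x)\cdot\lambda_{-t}(x)=1$ in $\mathcal{B}(G)[[t]]$. Partitions: $\mu\vdash i$ means that $\mu=(\mu_1,\dots,\mu_l)$ is a partition of $i$ into positive parts $\mu_1\ge\dots\ge\mu_l$; its length is $\ell(\mu)=l$. If $\mu_1=\dots=\mu_{\alpha_1}>\mu_{\alpha_1+1}=\dots=\mu_{\alpha_1+\alpha_2}>\dots>\mu_{l-\alpha_{l'}+1}=\dots=\mu_l$,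 then $\alpha(\mu):=(\alpha_1,\dots,\alpha_{l'})$ (the tuple of multiplicities of the distinct parts, in decreasing order of the parts), and $\binom{\ell(\mu)}{\alpha(\mu)}:=\frac{l!}{\alpha_1!\cdots\alpha_{l'}!}$. For a $G$-set $S$ of cardinality $\ge i$ and $\mu\vdash i$, $\mathcal{P}_\mu(S)$ is the $G$-set of $\ell(\mu)$-tuples $(T_1,\dots,T_{\ell(\mu)})$ of pairwise disjoint subsets of $S$ with $|T_j|=\mu_j$ for each $j$, with $G$ acting by $g(T_1,\dots,T_{\ell(\mu)})=(gT_1,\dots,gT_{\ell(\mu)})$. *)

theory Defs
  imports "HOL-Combinatorics.Permutations" "HOL-Algebra.Group_Action" "HOL-Algebra.Ring"
begin

section \<open>Finite G-sets\<close>

text \<open>A G-set is a carrier together with its action. Every construction restricts the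
  action to the carrier, because \<^const>\<open>group_action\<close> asks for extensional permutations.\<close>

type_synonym ('g, 'b) gset = "'b set \<times> ('g \<Rightarrow> 'b \<Rightarrow> 'b)"

definition fin_gset :: "('g, 'm) monoid_scheme \<Rightarrow> ('g, 'b) gset \<Rightarrow> bool" where
  "fin_gset G X \<longleftrightarrow> group_action G (fst X) (snd X) \<and> finite (fst X)"

definition gset_iso ::
    "('g, 'm) monoid_scheme \<Rightarrow> ('g, 'b) gset \<Rightarrow> ('g, 'c) gset \<Rightarrow> bool" where
  "gset_iso G X Y \<longleftrightarrow>
     (\<exists>f. bij_betw f (fst X) (fst Y) \<and>
          (\<forall>g\<in>carrier G. \<forall>x\<in>fst X. f (snd X g x) = snd Y g (f x)))"

definition gset_sum :: "('g, 'b) gset \<Rightarrow> ('g, 'c) gset \<Rightarrow> ('g, 'b + 'c) gset" where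
  "gset_sum X Y =
     (fst X <+> fst Y, \<lambda>g. restrict (map_sum (snd X g) (snd Y g)) (fst X <+> fst Y))"

definition gset_prod :: "('g, 'b) gset \<Rightarrow> ('g, 'c) gset \<Rightarrow> ('g, 'b \<times> 'c) gset" where
  "gset_prod X Y =
     (fst X \<times> fst Y, \<lambda>g. restrict (map_prod (snd X g) (snd Y g)) (fst X \<times> fst Y))"

definition gset_empty :: "('g, nat) gset" where
  "gset_empty = ({}, \<lambda>g. restrict id {})"

definition gset_point :: "('g, nat) gset" where
  "gset_point = ({0}, \<lambda>g. restrict id {0})"

text \<open>The symmetric power: the orbits of the symmetric group on \<open>{..<n}\<close> acting on the
  lists of length \<open>n\<close> over the carrier.\<close>

definition tuples :: "nat \<Rightarrow> 'b set \<Rightarrow> 'b list set" where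
  "tuples n A = {xs. set xs \<subseteq> A \<and> length xs = n}"

definition perm_rel :: "nat \<Rightarrow> 'b set \<Rightarrow> ('b list \<times> 'b list) set" where
  "perm_rel n A =
     {(xs, ys). xs \<in> tuples n A \<and> (\<exists>p. p permutes {..<n} \<and> ys = permute_list p xs)}"

definition sym_power :: "nat \<Rightarrow> ('g, 'b) gset \<Rightarrow> ('g, 'b list set) gset" where
  "sym_power n X =
     (tuples n (fst X) // perm_rel n (fst X),
      \<lambda>g. restrict (\<lambda>C. map (snd X g) ` C) (tuples n (fst X) // perm_rel n (fst X)))"


section \<open>The Burnside ring\<close>

text \<open>\<open>gdiff G X Y\<close> is the formal difference \<open>[X] - [Y]\<close> in the Grothendieck group: the pair
  \<open>(X, Y)\<close> modulo \<open>(X, Y) \<sim> (X', Y')\<close> iff \<open>X + Y' + Z \<cong> X' + Y + Z\<close> for some \<open>Z\<close>. The class is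
  recorded by its representatives carried by subsets of \<^typ>\<open>nat\<close>. As every finite G-set is
  isomorphic to such a one, this loses nothing, and \<open>X\<close> and \<open>Y\<close> may live on any types.\<close>

type_synonym 'g burnside = "(('g, nat) gset \<times> ('g, nat) gset) set"

definition gdiff ::
    "('g, 'm) monoid_scheme \<Rightarrow> ('g, 'b) gset \<Rightarrow> ('g, 'c) gset \<Rightarrow> 'g burnside" where
  "gdiff G X Y =
     {(X', Y'). fin_gset G X' \<and> fin_gset G Y' \<and>
        (\<exists>Z :: ('g, nat) gset. fin_gset G Z \<and>
           gset_iso G (gset_sum (gset_sum X Y') Z) (gset_sum (gset_sum X' Y) Z))}"

definition gclass :: "('g, 'm) monoid_scheme \<Rightarrow> ('g, 'b) gset \<Rightarrow> 'g burnside" where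
  "gclass G X = gdiff G X gset_empty"

text \<open>The unions below range over all representatives of the two classes; the united sets
  all coincide.\<close>

definition burnside_ring :: "('g, 'm) monoid_scheme \<Rightarrow> 'g burnside ring" where
  "burnside_ring G =
     \<lparr>carrier = {gdiff G X Y | (X :: ('g, nat) gset) (Y :: ('g, nat) gset).
        fin_gset G X \<and> fin_gset G Y},
      mult = (\<lambda>p q. \<Union>(A, B)\<in>p. \<Union>(C, D)\<in>q.
        gdiff G (gset_sum (gset_prod A C) (gset_prod B D))
                (gset_sum (gset_prod A D) (gset_prod B C))),
      one = gclass G gset_point,
      zero = gclass G gset_empty,
      add = (\<lambda>p q. \<Union>(A, B)\<in>p. \<Union>(C, D)\<in>q. gdiff G (gset_sum A C) (gset_sum B D))\<rparr>"


section \<open>Power series and the lambda-structure\<close>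

definition power_series :: "('a, 'm) ring_scheme \<Rightarrow> (nat \<Rightarrow> 'a) ring" where
  "power_series R =
     \<lparr>carrier = {p. \<forall>n. p n \<in> carrier R},
      mult = (\<lambda>p q n. \<Oplus>\<^bsub>R\<^esub>i\<in>{..n}. p i \<otimes>\<^bsub>R\<^esub> q (n - i)),
      one = (\<lambda>n. if n = 0 then \<one>\<^bsub>R\<^esub> else \<zero>\<^bsub>R\<^esub>),
      zero = (\<lambda>n. \<zero>\<^bsub>R\<^esub>),
      add = (\<lambda>p q n. p n \<oplus>\<^bsub>R\<^esub> q n)\<rparr>"

definition subst_neg :: "('a, 'm) ring_scheme \<Rightarrow> (nat \<Rightarrow> 'a) \<Rightarrow> nat \<Rightarrow> 'a" where
  "subst_neg R p = (\<lambda>n. [((-1) ^ n :: int)] \<cdot>\<^bsub>R\<^esub> p n)"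

text \<open>\<open>burnside_sigma G x\<close> is the series \<open>\<sigma>\<^sub>t(x)\<close> and \<open>burnside_lambda G x\<close> is \<open>\<lambda>\<^sub>t(x)\<close>.\<close>

definition burnside_sigma :: "('g, 'm) monoid_scheme \<Rightarrow> 'g burnside \<Rightarrow> nat \<Rightarrow> 'g burnside" where
  "burnside_sigma G =
     (THE s. s \<in> carrier (burnside_ring G) \<rightarrow>\<^sub>E carrier (power_series (burnside_ring G)) \<and>
        (\<forall>X :: ('g, nat) gset. fin_gset G X \<longrightarrow>
           (\<forall>n. s (gclass G X) n = gclass G (sym_power n X))) \<and>
        (\<forall>x\<in>carrier (burnside_ring G). \<forall>y\<in>carrier (burnside_ring G).
           s (x \<oplus>\<^bsub>burnside_ring G\<^esub> y) = s x \<otimes>\<^bsub>power_series (burnside_ring G)\<^esub> s y))"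

definition burnside_lambda :: "('g, 'm) monoid_scheme \<Rightarrow> 'g burnside \<Rightarrow> nat \<Rightarrow> 'g burnside" where
  "burnside_lambda G x =
     (THE l. l \<in> carrier (power_series (burnside_ring G)) \<and>
        burnside_sigma G x \<otimes>\<^bsub>power_series (burnside_ring G)\<^esub> subst_neg (burnside_ring G) l
          = \<one>\<^bsub>power_series (burnside_ring G)\<^esub>)"


section \<open>Partitions and set tuples\<close>

definition partitions :: "nat \<Rightarrow> nat list set" where
  "partitions i = {\<mu>. sorted_wrt (\<ge>) \<mu> \<and> (\<forall>m\<in>set \<mu>. 0 < m) \<and> sum_list \<mu> = i}"

definition multiplicities :: "nat list \<Rightarrow> nat list" where
  "multiplicities \<mu> = map (count_list \<mu>) (remdups_adj \<mu>)"

definition multinomial :: "nat \<Rightarrow> nat list \<Rightarrow> nat" where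
  "multinomial l \<alpha> = fact l div prod_list (map fact \<alpha>)"

definition set_tuples :: "nat list \<Rightarrow> 'b set \<Rightarrow> 'b set list set" where
  "set_tuples \<mu> A =
     {Ts. length Ts = length \<mu> \<and>
        (\<forall>j<length \<mu>. Ts ! j \<subseteq> A \<and> card (Ts ! j) = \<mu> ! j) \<and>
        (\<forall>j<length \<mu>. \<forall>k<length \<mu>. j \<noteq> k \<longrightarrow> Ts ! j \<inter> Ts ! k = {})}"

definition gset_tuples :: "nat list \<Rightarrow> ('g, 'b) gset \<Rightarrow> ('g, 'b set list) gset" where
  "gset_tuples \<mu> X =
     (set_tuples \<mu> (fst X), \<lambda>g. restrict (map (image (snd X g))) (set_tuples \<mu> (fst X)))"

end

(* The marks of a finite G-set X are the numbers of fixed points |X^H|, H a subset of G. By Burnside's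
   theorem they determine X up to isomorphism, so the Burnside ring embeds into the ring of
   integer-valued functions of H, and power series over it embed into families of integer power
   series. Since the symmetric powers of a disjoint union X + Y are convolutions, sigma_t([X] - [Y]) is
   sigma_t(X) / sigma_t(Y), and all that remains is to invert sigma_t(S).

   The H-fixed points of S^n / Sigma_n are the H-invariant multisets M of size n on S. Summing the
   claimed formula over compositions instead of partitions, its value at H is the sum of (-1)^l over
   lists (T_1, ..., T_l) of disjoint nonempty H-invariant subsets of S of total size i. That this
   inverts sigma_t(S) follows from a sign-reversing involution without fixed points on the pairs
   (M, (T_1, ..., T_l)) of positive total size. *)

theory Submission
  imports Defs "HOL-Combinatorics.Multiset_Permutations" "HOL-Computational_Algebra.Formal_Power_Series"
begin

text \<open>\<open>burnside_sigma\<close> and \<open>burnside_lambda\<close> are definite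
  descriptions, so each needs existence and uniqueness; the delicate point is sigma_t on formal
  differences. Marks are good for comparing and cancelling: each H gives a series in the integral
  domain of integer power series, where sigma_t(Y) can be cancelled. But an integer function of H
  need not come from the Burnside ring, so a quotient formed among marks does not by itself give an
  element. The tuple formula closes this gap. Its coefficients are integer combinations of classes
  and its marks are the reciprocal of sigma_t(Y), so sigma_t([X] - [Y]) can be defined as sigma_t(X)
  times the tuple series of Y. One identity thus serves both to construct the sigma-structure and,
  with -t in place of t, to compute lambda_t.\<close>

definition mark :: "('g, 'm) monoid_scheme \<Rightarrow> ('g, 'b) gset \<Rightarrow> 'g set \<Rightarrow> int" where
  "mark G X H = int (card {x \<in> fst X. \<forall>g \<in> H \<inter> carrier G. snd X g x = x})"

text \<open>The sum, the product, the symmetric power, the set tuples and invariant subsets are all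
  brought into this form, so that axioms and fixed points can be checked with the unrestricted
  action.\<close>

definition restr_action :: "'b set \<Rightarrow> ('g \<Rightarrow> 'b \<Rightarrow> 'b) \<Rightarrow> ('g, 'b) gset" where
  "restr_action A \<psi> = (A, \<lambda>g. restrict (\<psi> g) A)"

lemma mark_restr_action:
  "mark G (restr_action A \<psi>) H = int (card {x \<in> A. \<forall>g \<in> H \<inter> carrier G. \<psi> g x = x})"
  unfolding mark_def restr_action_def by (rule arg_cong[where f = "\<lambda>A. int (card A)"]) auto

lemma gset_iso_restr_action:
  "gset_iso G (restr_action A \<psi>) (restr_action B \<chi>) \<longleftrightarrow>
     (\<exists>f. bij_betw f A B \<and> (\<forall>g \<in> carrier G. \<forall>x \<in> A. f (\<psi> g x) = \<chi> g (f x)))"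
  unfolding gset_iso_def restr_action_def
  by (rule ex_cong1) (auto simp: bij_betw_def)

section \<open>Finite G-sets, their constructions and their marks\<close>

locale burnside_group = group G for G :: "('g, 'm) monoid_scheme" (structure) +
  assumes finite_carrier: "finite (carrier G)"
begin

text \<open>Each action map is bijective because the inverse element acts as its inverse, so the
  homomorphism into \<open>BijGroup\<close> comes down to pointwise laws and extensionality.\<close>

lemma fin_gset_iff:
  "fin_gset G X \<longleftrightarrow> finite (fst X) \<and> (\<forall>g \<in> carrier G. snd X g \<in> extensional (fst X)) \<and>
     (\<forall>g \<in> carrier G. \<forall>x \<in> fst X. snd X g x \<in> fst X) \<and> (\<forall>x \<in> fst X. snd X \<one> x = x) \<and>
     (\<forall>g \<in> carrier G. \<forall>h \<in> carrier G. \<forall>x \<in> fst X. snd X (g \<otimes> h) x = snd X g (snd X h x))"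
  (is "?L \<longleftrightarrow> ?R")
proof
  assume L: ?L
  then interpret group_action G "fst X" "snd X" by (simp add: fin_gset_def)
  have "snd X \<one> x = x" if "x \<in> fst X" for x
    using that fun_cong[OF id_eq_one, of x] by simp
  moreover have "snd X g \<in> extensional (fst X)" if "g \<in> carrier G" for g
    using bij_prop0[OF that] by (rule Bij_imp_extensional)
  moreover have "snd X g x \<in> fst X" if "g \<in> carrier G" "x \<in> fst X" for g x
    by (rule element_image[OF that refl])
  moreover have "finite (fst X)"
    using L by (simp add: fin_gset_def)
  ultimately show ?R
    by (simp add: composition_rule)
next
  assume R: ?R
  have inv: "snd X (inv g) (snd X g x) = x" "snd X g (snd X (inv g) x) = x"
    if "g \<in> carrier G" "x \<in> fst X" for g x
    using R that by (metis inv_closed l_inv, metis inv_closed r_inv)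
  have bij: "snd X g \<in> Bij (fst X)" if g: "g \<in> carrier G" for g
    unfolding Bij_def using R g inv[OF g] inv_closed[OF g]
    by (auto intro!: bij_betw_byWitness[where f' = "snd X (inv g)"])
  have "snd X \<in> hom G (BijGroup (fst X))"
  proof (rule homI)
    fix g h assume gh: "g \<in> carrier G" "h \<in> carrier G"
    show "snd X (g \<otimes> h) = snd X g \<otimes>\<^bsub>BijGroup (fst X)\<^esub> snd X h"
      using R gh by (auto simp: BijGroup_def bij compose_def fun_eq_iff extensional_def)
  qed (auto simp: BijGroup_def bij)
  then have "group_hom G (BijGroup (fst X)) (snd X)"
    by (simp add: group_hom_def group_hom_axioms_def group_BijGroup is_group)
  then show ?L
    using R by (simp add: fin_gset_def group_action_def)
qed

lemma fin_gsetD: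
  assumes "fin_gset G X"
  shows fin_gset_finite: "finite (fst X)"
    and fin_gset_closed: "g \<in> carrier G \<Longrightarrow> x \<in> fst X \<Longrightarrow> snd X g x \<in> fst X"
    and fin_gset_one: "x \<in> fst X \<Longrightarrow> snd X \<one> x = x"
    and fin_gset_mult:
      "g \<in> carrier G \<Longrightarrow> h \<in> carrier G \<Longrightarrow> x \<in> fst X \<Longrightarrow> snd X (g \<otimes> h) x = snd X g (snd X h x)"
  using assms by (auto simp: fin_gset_iff)

lemma fin_gset_inv:
  assumes "fin_gset G X" "g \<in> carrier G" "x \<in> fst X"
  shows "snd X (inv g) (snd X g x) = x" "snd X g (snd X (inv g) x) = x"
  using fin_gset_mult[OF assms(1) inv_closed[OF assms(2)] assms(2,3)]
    fin_gset_mult[OF assms(1,2) inv_closed[OF assms(2)] assms(3)] fin_gset_one[OF assms(1,3)]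
  by (simp_all add: assms(2))

lemma fin_gset_inj:
  assumes "fin_gset G X" "g \<in> carrier G"
  shows "inj_on (snd X g) (fst X)"
  by (rule inj_on_inverseI[where g = "snd X (inv g)"]) (rule fin_gset_inv[OF assms])

lemma fin_gset_restr_action:
  assumes "finite A" "\<And>g x. g \<in> carrier G \<Longrightarrow> x \<in> A \<Longrightarrow> \<psi> g x \<in> A"
    "\<And>x. x \<in> A \<Longrightarrow> \<psi> \<one> x = x"
    "\<And>g h x. g \<in> carrier G \<Longrightarrow> h \<in> carrier G \<Longrightarrow> x \<in> A \<Longrightarrow> \<psi> (g \<otimes> h) x = \<psi> g (\<psi> h x)"
  shows "fin_gset G (restr_action A \<psi>)"
  unfolding fin_gset_iff using assms by (auto simp: restr_action_def)

lemma fin_gset_sub: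
  assumes "fin_gset G X" "A \<subseteq> fst X" "\<And>g x. g \<in> carrier G \<Longrightarrow> x \<in> A \<Longrightarrow> snd X g x \<in> A"
  shows "fin_gset G (restr_action A (snd X))"
  using assms by (intro fin_gset_restr_action) (auto simp: fin_gsetD subset_iff intro: finite_subset)

lemma gset_iso_sym:
  assumes "fin_gset G X" "gset_iso G X Y"
  shows "gset_iso G Y X"
proof -
  from assms(2) obtain f where f: "bij_betw f (fst X) (fst Y)"
    "\<And>g x. g \<in> carrier G \<Longrightarrow> x \<in> fst X \<Longrightarrow> f (snd X g x) = snd Y g (f x)"
    by (auto simp: gset_iso_def)
  let ?h = "the_inv_into (fst X) f"
  have "?h (snd Y g y) = snd X g (?h y)" if "g \<in> carrier G" "y \<in> fst Y" for g y
  proof -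
    have x: "?h y \<in> fst X" "f (?h y) = y"
      using f(1) that(2) by (auto simp: bij_betw_def the_inv_into_into f_the_inv_into_f)
    then have "f (snd X g (?h y)) = snd Y g y"
      using f(2) that(1) by simp
    then show ?thesis
      using f(1) x(1) that(1) fin_gset_closed[OF assms(1)]
      by (metis bij_betw_def the_inv_into_f_f)
  qed
  then show ?thesis
    unfolding gset_iso_def using bij_betw_the_inv_into[OF f(1)] by blast
qed

text \<open>An equivariant bijection restricts to the fixed points. Equality holds for every
  \<open>H\<close> of the type, as \<open>mark\<close> only looks at
  \<open>H \<inter> carrier G\<close>.\<close>

lemma mark_cong:
  assumes "fin_gset G X" "gset_iso G X Y"
  shows "mark G X = mark G Y"
proof
  fix H
  from assms(2) obtain f where f: "bij_betw f (fst X) (fst Y)"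
    "\<And>g x. g \<in> carrier G \<Longrightarrow> x \<in> fst X \<Longrightarrow> f (snd X g x) = snd Y g (f x)"
    by (auto simp: gset_iso_def)
  have *: "snd Y g (f x) = f x \<longleftrightarrow> snd X g x = x" if "g \<in> carrier G" "x \<in> fst X" for g x
    using f that fin_gset_closed[OF assms(1)] by (metis bij_betw_def inj_on_def)
  have "bij_betw f {x \<in> fst X. \<forall>g \<in> H \<inter> carrier G. snd X g x = x}
     {x \<in> fst Y. \<forall>g \<in> H \<inter> carrier G. snd Y g x = x}"
    by (rule bij_betw_Collect[OF f(1)]) (use * in auto)
  then show "mark G X H = mark G Y H"
    unfolding mark_def by (simp add: bij_betw_same_card)
qed

lemma gset_sum_restr:
  "gset_sum X Y = restr_action (fst X <+> fst Y) (\<lambda>g. map_sum (snd X g) (snd Y g))"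
  by (simp add: gset_sum_def restr_action_def)

lemma fin_gset_sum:
  assumes "fin_gset G X" "fin_gset G Y"
  shows "fin_gset G (gset_sum X Y)"
  unfolding gset_sum_restr
  by (rule fin_gset_restr_action) (use assms in \<open>auto simp: fin_gsetD\<close>)

lemma mark_sum:
  assumes "fin_gset G X" "fin_gset G Y"
  shows "mark G (gset_sum X Y) H = mark G X H + mark G Y H"
proof -
  have "{x \<in> fst X <+> fst Y. \<forall>g \<in> H \<inter> carrier G. map_sum (snd X g) (snd Y g) x = x}
     = {x \<in> fst X. \<forall>g \<in> H \<inter> carrier G. snd X g x = x} <+>
       {x \<in> fst Y. \<forall>g \<in> H \<inter> carrier G. snd Y g x = x}"
    by auto
  then show ?thesis
    unfolding gset_sum_restr mark_restr_action
    by (simp add: mark_def card_Plus fin_gset_finite assms)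
qed

lemma gset_prod_restr:
  "gset_prod X Y = restr_action (fst X \<times> fst Y) (\<lambda>g. map_prod (snd X g) (snd Y g))"
  by (simp add: gset_prod_def restr_action_def)

lemma fin_gset_prod:
  assumes "fin_gset G X" "fin_gset G Y"
  shows "fin_gset G (gset_prod X Y)"
  unfolding gset_prod_restr
  by (rule fin_gset_restr_action) (use assms in \<open>auto simp: fin_gsetD\<close>)

lemma mark_prod: "mark G (gset_prod X Y) H = mark G X H * mark G Y H"
proof -
  have "{x \<in> fst X \<times> fst Y. \<forall>g \<in> H \<inter> carrier G. map_prod (snd X g) (snd Y g) x = x}
     = {x \<in> fst X. \<forall>g \<in> H \<inter> carrier G. snd X g x = x} \<times>
       {x \<in> fst Y. \<forall>g \<in> H \<inter> carrier G. snd Y g x = x}"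
    by auto
  then show ?thesis
    unfolding gset_prod_restr mark_restr_action
    by (simp add: mark_def card_cartesian_product)
qed

lemma fin_gset_empty: "fin_gset G gset_empty"
  by (auto simp: fin_gset_iff gset_empty_def)

lemma mark_empty: "mark G gset_empty H = 0"
  by (simp add: mark_def gset_empty_def)

lemma fin_gset_point: "fin_gset G gset_point"
  by (auto simp: fin_gset_iff gset_point_def)

lemma mark_point: "mark G gset_point H = 1"
  by (simp add: mark_def gset_point_def)

text \<open>Elements of the Burnside ring only contain G-sets carried by natural numbers; the copy
  gives a G-set on any other type a representative there.\<close>

lemma ex_nat_copy:
  fixes X :: "('g, 'b) gset"
  assumes "fin_gset G X"
  obtains X' :: "('g, nat) gset" where "fin_gset G X'" "gset_iso G X X'"
proof -
  obtain f :: "'b \<Rightarrow> nat" where f: "inj_on f (fst X)"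
    using finite_imp_inj_to_nat_seg[OF fin_gset_finite[OF assms]] by blast
  let ?X' = "restr_action (f ` fst X) (\<lambda>g y. f (snd X g (the_inv_into (fst X) f y)))"
  have "fin_gset G ?X'"
    by (rule fin_gset_restr_action) (auto simp: fin_gsetD[OF assms] the_inv_into_f_f[OF f])
  moreover have "gset_iso G X ?X'"
    unfolding gset_iso_def
    by (rule exI[of _ f]) (auto simp: restr_action_def the_inv_into_f_f[OF f] bij_betw_def f)
  ultimately show ?thesis ..
qed


section \<open>Marks determine a finite G-set\<close>

definition stab :: "('g, 'b) gset \<Rightarrow> 'b \<Rightarrow> 'g set" where
  "stab X x = {g \<in> carrier G. snd X g x = x}"

lemma finite_stab: "finite (stab X x)"
  using finite_carrier by (simp add: stab_def)

definition orb :: "('g, 'b) gset \<Rightarrow> 'b \<Rightarrow> 'b set" where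
  "orb X x = (\<lambda>g. snd X g x) ` carrier G"

text \<open>Through this, equal marks let a stabilizer in one G-set be compared with the stabilizers
  in another.\<close>

lemma mark_pos_iff:
  assumes "fin_gset G X" "H \<subseteq> carrier G"
  shows "0 < mark G X H \<longleftrightarrow> (\<exists>x \<in> fst X. H \<subseteq> stab X x)"
  using assms fin_gset_finite[OF assms(1)]
  by (auto simp: mark_def card_gt_0_iff stab_def subset_iff Int_absorb2)

lemma orb_subset:
  assumes "fin_gset G X" "x \<in> fst X"
  shows "orb X x \<subseteq> fst X" "x \<in> orb X x"
  using assms(2) fin_gset_one[OF assms] fin_gset_closed[OF assms(1)]
  by (auto simp: orb_def image_iff intro!: bexI[of _ \<one>])

lemma orb_closed:
  assumes "fin_gset G X" "x \<in> fst X" "g \<in> carrier G" "y \<in> orb X x"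
  shows "snd X g y \<in> orb X x"
  using assms by (auto simp: orb_def simp flip: fin_gset_mult)

lemma orb_compl_closed:
  assumes X: "fin_gset G X" "x \<in> fst X" and g: "g \<in> carrier G" and y: "y \<in> fst X - orb X x"
  shows "snd X g y \<in> fst X - orb X x"
proof -
  have "y \<in> orb X x" if "snd X g y \<in> orb X x"
    using orb_closed[OF X inv_closed[OF g] that] y fin_gset_inv(1)[OF X(1) g, of y] by simp
  then show ?thesis
    using y g fin_gset_closed[OF X(1)] by blast
qed

lemma orb_eq_iff:
  assumes "fin_gset G X" "x \<in> fst X" "g \<in> carrier G" "h \<in> carrier G"
  shows "snd X g x = snd X h x \<longleftrightarrow> inv h \<otimes> g \<in> stab X x"
proof -
  have "snd X (inv h \<otimes> g) x = snd X (inv h) (snd X g x)"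
    using assms by (simp add: fin_gset_mult)
  moreover have "snd X g x = snd X h x" if "snd X (inv h) (snd X g x) = x"
    using fin_gset_inv(2)[OF assms(1,4) fin_gset_closed[OF assms(1,3,2)]] that by simp
  moreover have "snd X (inv h) (snd X g x) = x" if "snd X g x = snd X h x"
    unfolding that by (rule fin_gset_inv(1)[OF assms(1,4,2)])
  moreover have "inv h \<otimes> g \<in> carrier G"
    using assms by simp
  ultimately show ?thesis
    unfolding stab_def by (metis (mono_tags, lifting) mem_Collect_eq)
qed

text \<open>Both orbits are modelled on the cosets of the common stabilizer: by
  \<open>orb_eq_iff\<close> two group elements agree on \<open>x\<close> exactly when they agree on
  \<open>y\<close>, so g x may be sent to g y.\<close>

lemma orb_iso:
  assumes X: "fin_gset G X" "x \<in> fst X" and Y: "fin_gset G Y" "y \<in> fst Y"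
    and stab: "stab X x = stab Y y"
  shows "gset_iso G (restr_action (orb X x) (snd X)) (restr_action (orb Y y) (snd Y))"
proof -
  \<comment> \<open>The element moving \<open>x\<close> to \<open>z\<close> is chosen arbitrarily;
    the next fact shows that the choice does not affect the value.\<close>
  define f where "f z = snd Y (SOME g. g \<in> carrier G \<and> snd X g x = z) y" for z
  have f: "f (snd X g x) = snd Y g y" if g: "g \<in> carrier G" for g
  proof -
    let ?h = "SOME h. h \<in> carrier G \<and> snd X h x = snd X g x"
    have "?h \<in> carrier G \<and> snd X ?h x = snd X g x"
      by (rule someI[of _ g]) (use g in auto)
    then show ?thesis
      unfolding f_def using orb_eq_iff[OF X] orb_eq_iff[OF Y] stab g by blast
  qed
  have "inj_on f (orb X x)"
    by (rule inj_onI) (use f orb_eq_iff[OF X] orb_eq_iff[OF Y] stab in \<open>auto simp: orb_def\<close>)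
  moreover have "f ` orb X x = orb Y y"
    by (simp add: orb_def image_image f)
  moreover have "f (snd X g z) = snd Y g (f z)" if g: "g \<in> carrier G" and z: "z \<in> orb X x" for g z
  proof -
    obtain h where h: "h \<in> carrier G" "z = snd X h x"
      using z unfolding orb_def by blast
    have "snd X g z = snd X (g \<otimes> h) x"
      unfolding h(2) by (rule fin_gset_mult[OF X(1) g h(1) X(2), symmetric])
    moreover have "snd Y g (f z) = snd Y (g \<otimes> h) y"
      unfolding h(2) f[OF h(1)] by (rule fin_gset_mult[OF Y(1) g h(1) Y(2), symmetric])
    ultimately show ?thesis
      using f[OF m_closed[OF g h(1)]] by simp
  qed
  ultimately show ?thesis
    unfolding gset_iso_restr_action bij_betw_def by blast
qed

lemma gset_iso_union:
  assumes iso: "gset_iso G (restr_action A (snd X)) (restr_action B (snd Y))"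
    "gset_iso G (restr_action (fst X - A) (snd X)) (restr_action (fst Y - B) (snd Y))"
    and A: "A \<subseteq> fst X" "B \<subseteq> fst Y"
    and closed: "\<And>g x. g \<in> carrier G \<Longrightarrow> x \<in> A \<Longrightarrow> snd X g x \<in> A"
      "\<And>g x. g \<in> carrier G \<Longrightarrow> x \<in> fst X - A \<Longrightarrow> snd X g x \<in> fst X - A"
  shows "gset_iso G X Y"
proof -
  from iso obtain f1 f2 where f1: "bij_betw f1 A B"
    "\<And>g x. g \<in> carrier G \<Longrightarrow> x \<in> A \<Longrightarrow> f1 (snd X g x) = snd Y g (f1 x)"
    and f2: "bij_betw f2 (fst X - A) (fst Y - B)"
    "\<And>g x. g \<in> carrier G \<Longrightarrow> x \<in> fst X - A \<Longrightarrow> f2 (snd X g x) = snd Y g (f2 x)"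
    unfolding gset_iso_restr_action by meson
  have "bij_betw (\<lambda>x. if x \<in> A then f1 x else f2 x) (A \<union> (fst X - A)) (B \<union> (fst Y - B))"
    by (rule bij_betw_disjoint_Un) (use f1 f2 in auto)
  moreover have "A \<union> (fst X - A) = fst X" "B \<union> (fst Y - B) = fst Y"
    using A by auto
  ultimately show ?thesis
    unfolding gset_iso_def
    by (intro exI[of _ "\<lambda>x. if x \<in> A then f1 x else f2 x"]) (use closed f1 f2 in auto)
qed

lemma mark_diff:
  assumes "fin_gset G X" "A \<subseteq> fst X"
  shows "mark G (restr_action (fst X - A) (snd X)) H
    = mark G X H - mark G (restr_action A (snd X)) H"
proof -
  let ?F = "\<lambda>B. {x \<in> B. \<forall>g \<in> H \<inter> carrier G. snd X g x = x}"
  have "card (?F (fst X - A) \<union> ?F A) = card (?F (fst X - A)) + card (?F A)"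
    by (rule card_Un_disjoint) (use assms(2) fin_gset_finite[OF assms(1)] finite_subset[OF assms(2)] in auto)
  moreover have "?F (fst X - A) \<union> ?F A = ?F (fst X)"
    using assms(2) by auto
  ultimately show ?thesis
    unfolding mark_restr_action by (simp add: mark_def)
qed

text \<open>The largest stabilizer occurring in \<open>X\<close> also occurs in \<open>Y\<close>; the two corresponding orbits
  are isomorphic and can be removed.\<close>

theorem gset_iso_if_mark_eq:
  assumes "fin_gset G X" "fin_gset G Y" "\<And>H. H \<subseteq> carrier G \<Longrightarrow> mark G X H = mark G Y H"
  shows "gset_iso G X Y"
  using assms
proof (induction "card (fst X)" arbitrary: X Y rule: less_induct)
  case less
  note X = less.prems(1) and Y = less.prems(2) and eq = less.prems(3)
  show ?case
  proof (cases "fst X = {}")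
    case True
    \<comment> \<open>The condition for the empty set is vacuous, so this mark is the number of
      points.\<close>
    then have "mark G Y {} = 0"
      using eq[of "{}"] by (simp add: mark_def)
    then have "fst Y = {}"
      using fin_gset_finite[OF Y] by (simp add: mark_def)
    then show ?thesis
      using True by (auto simp: gset_iso_def bij_betw_def)
  next
    case False
    have "finite ((\<lambda>x. card (stab X x)) ` fst X)" "(\<lambda>x. card (stab X x)) ` fst X \<noteq> {}"
      using False fin_gset_finite[OF X] by auto
    from Max_in[OF this] obtain x where x: "x \<in> fst X"
      and xmax: "card (stab X x) = Max ((\<lambda>x. card (stab X x)) ` fst X)"
      by auto
    have max: "card (stab X x') \<le> card (stab X x)" if "x' \<in> fst X" for x'
      unfolding xmax using that fin_gset_finite[OF X] by auto
    have sub: "stab X z \<subseteq> carrier G" "stab Y w \<subseteq> carrier G" for z w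
      by (auto simp: stab_def)
    \<comment> \<open>The stabilizer of \<open>x\<close> fixes \<open>x\<close>, so by equality of
      marks it fixes some \<open>y\<close>; in turn the stabilizer of \<open>y\<close> fixes some
      \<open>x'\<close>. These inclusions collapse because the stabilizer of \<open>x\<close> has
      maximal size.\<close>
    obtain y where y: "y \<in> fst Y" "stab X x \<subseteq> stab Y y"
      using mark_pos_iff[OF X sub(1)[of x]] mark_pos_iff[OF Y sub(1)[of x]]
        eq[OF sub(1)[of x]] x by auto
    obtain x' where x': "x' \<in> fst X" "stab Y y \<subseteq> stab X x'"
      using mark_pos_iff[OF X sub(2)[of y]] mark_pos_iff[OF Y sub(2)[of y]]
        eq[OF sub(2)[of y]] y by auto
    have "card (stab Y y) \<le> card (stab X x)"
      using max[OF x'(1)] card_mono[OF finite_stab x'(2)] by simp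
    then have stab: "stab X x = stab Y y"
      using card_seteq[OF finite_stab y(2)] by blast
    let ?A = "orb X x" and ?B = "orb Y y"
    have AX: "?A \<subseteq> fst X" "x \<in> ?A" and BY: "?B \<subseteq> fst Y"
      using orb_subset[OF X x] orb_subset[OF Y y(1)] by auto
    have iso: "gset_iso G (restr_action ?A (snd X)) (restr_action ?B (snd Y))"
      by (rule orb_iso[OF X x Y y(1) stab])
    have finA: "fin_gset G (restr_action ?A (snd X))"
      by (rule fin_gset_sub[OF X AX(1)]) (rule orb_closed[OF X x])
    have "gset_iso G (restr_action (fst X - ?A) (snd X)) (restr_action (fst Y - ?B) (snd Y))"
    proof (rule less.hyps)
      show "card (fst (restr_action (fst X - ?A) (snd X))) < card (fst X)"
        unfolding restr_action_def using AX x fin_gset_finite[OF X]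
        by (auto intro!: psubset_card_mono)
      show "fin_gset G (restr_action (fst X - ?A) (snd X))"
        by (rule fin_gset_sub[OF X]) (use orb_compl_closed[OF X x] in auto)
      show "fin_gset G (restr_action (fst Y - ?B) (snd Y))"
        by (rule fin_gset_sub[OF Y]) (use orb_compl_closed[OF Y y(1)] in auto)
      show "mark G (restr_action (fst X - ?A) (snd X)) H = mark G (restr_action (fst Y - ?B) (snd Y)) H"
        if "H \<subseteq> carrier G" for H
        unfolding mark_diff[OF X AX(1)] mark_diff[OF Y BY] mark_cong[OF finA iso] eq[OF that] ..
    qed
    then show ?thesis
      by (rule gset_iso_union[OF iso _ AX(1) BY])
        (use orb_closed[OF X x] orb_compl_closed[OF X x] in auto)
  qed
qed


section \<open>The Burnside ring as a ring of virtual mark functions\<close>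

abbreviation BR :: "'g burnside ring" where "BR \<equiv> burnside_ring G"

text \<open>These functions are the image of the Burnside ring in the ring of all integer functions
  of \<open>H\<close>, a version of its ghost ring.\<close>

definition virtual :: "('g set \<Rightarrow> int) \<Rightarrow> bool" where
  "virtual f \<longleftrightarrow> (\<exists>(X :: ('g, nat) gset) (Y :: ('g, nat) gset).
     fin_gset G X \<and> fin_gset G Y \<and> f = (\<lambda>H. mark G X H - mark G Y H))"

text \<open>The inverse of the passage to marks. It is empty unless \<open>f\<close> is virtual,
  which is why that condition accompanies it below.\<close>

definition mark_class :: "('g set \<Rightarrow> int) \<Rightarrow> 'g burnside" where
  "mark_class f = {(X, Y). fin_gset G X \<and> fin_gset G Y \<and> (\<forall>H. mark G X H - mark G Y H = f H)}"

text \<open>The auxiliary summand \<open>Z\<close> drops out of an equation between integer marks.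
  Conversely, equal marks give an isomorphism already with \<open>Z\<close> empty, by
  \<open>gset_iso_if_mark_eq\<close>.\<close>

lemma gdiff_eq_mark_class:
  assumes "fin_gset G X" "fin_gset G Y"
  shows "gdiff G X Y = mark_class (\<lambda>H. mark G X H - mark G Y H)"
proof -
  have "(\<exists>Z :: ('g, nat) gset. fin_gset G Z \<and>
      gset_iso G (gset_sum (gset_sum X Y') Z) (gset_sum (gset_sum X' Y) Z)) \<longleftrightarrow>
    (\<forall>H. mark G X' H - mark G Y' H = mark G X H - mark G Y H)"
    (is "?L \<longleftrightarrow> ?R") if "fin_gset G X'" "fin_gset G Y'" for X' Y' :: "('g, nat) gset"
  proof
    assume ?L
    then obtain Z :: "('g, nat) gset" where Z: "fin_gset G Z"
      "gset_iso G (gset_sum (gset_sum X Y') Z) (gset_sum (gset_sum X' Y) Z)" by blast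
    from mark_cong[OF _ Z(2)] show ?R
      using that assms Z(1) by (auto simp: fin_gset_sum mark_sum fun_eq_iff algebra_simps)
  next
    assume R: ?R
    have "gset_iso G (gset_sum (gset_sum X Y') gset_empty) (gset_sum (gset_sum X' Y) gset_empty)"
    proof (rule gset_iso_if_mark_eq)
      fix H
      show "mark G (gset_sum (gset_sum X Y') gset_empty) H
          = mark G (gset_sum (gset_sum X' Y) gset_empty) H"
        using R[rule_format, of H] that assms by (simp add: fin_gset_sum mark_sum fin_gset_empty)
    qed (simp_all add: that assms fin_gset_sum fin_gset_empty)
    then show ?L
      using fin_gset_empty by blast
  qed
  then show ?thesis
    unfolding gdiff_def mark_class_def by blast
qed

lemma gclass_eq_mark_class: "fin_gset G X \<Longrightarrow> gclass G X = mark_class (mark G X)"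
  by (simp add: gclass_def gdiff_eq_mark_class fin_gset_empty mark_empty)

lemma virtual_diff:
  fixes X :: "('g, 'b) gset" and Y :: "('g, 'c) gset"
  assumes "fin_gset G X" "fin_gset G Y"
  shows "virtual (\<lambda>H. mark G X H - mark G Y H)"
proof -
  obtain X' :: "('g, nat) gset" where X': "fin_gset G X'" "gset_iso G X X'"
    using ex_nat_copy[OF assms(1)] .
  obtain Y' :: "('g, nat) gset" where Y': "fin_gset G Y'" "gset_iso G Y Y'"
    using ex_nat_copy[OF assms(2)] .
  show ?thesis
    unfolding virtual_def mark_cong[OF assms(1) X'(2)] mark_cong[OF assms(2) Y'(2)]
    using X'(1) Y'(1) by blast
qed

lemma virtual_mark: "fin_gset G X \<Longrightarrow> virtual (mark G X)"
  using virtual_diff[OF _ fin_gset_empty, of X] by (simp add: mark_empty)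

lemma virtual_0: "virtual (\<lambda>H. 0)"
  using virtual_diff[OF fin_gset_empty fin_gset_empty] by (simp add: mark_empty)

lemma virtual_1: "virtual (\<lambda>H. 1)"
  using virtual_diff[OF fin_gset_point fin_gset_empty] by (simp add: mark_empty mark_point)

lemma virtual_uminus: "virtual f \<Longrightarrow> virtual (\<lambda>H. - f H)"
  unfolding virtual_def[of f] by (auto simp: virtual_diff)

lemma virtual_add:
  assumes "virtual f" "virtual h"
  shows "virtual (\<lambda>H. f H + h H)"
proof -
  obtain X Y :: "('g, nat) gset" where X: "fin_gset G X" "fin_gset G Y"
    and f: "f = (\<lambda>H. mark G X H - mark G Y H)"
    using assms(1) unfolding virtual_def by blast
  obtain X' Y' :: "('g, nat) gset" where Y: "fin_gset G X'" "fin_gset G Y'"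
    and h: "h = (\<lambda>H. mark G X' H - mark G Y' H)"
    using assms(2) unfolding virtual_def by blast
  have "virtual (\<lambda>H. mark G (gset_sum X X') H - mark G (gset_sum Y Y') H)"
    using X Y by (intro virtual_diff fin_gset_sum)
  then show ?thesis
    using X Y by (simp add: mark_sum f h algebra_simps)
qed

lemma virtual_mult:
  assumes "virtual f" "virtual h"
  shows "virtual (\<lambda>H. f H * h H)"
proof -
  obtain X Y :: "('g, nat) gset" where X: "fin_gset G X" "fin_gset G Y"
    and f: "f = (\<lambda>H. mark G X H - mark G Y H)"
    using assms(1) unfolding virtual_def by blast
  obtain X' Y' :: "('g, nat) gset" where Y: "fin_gset G X'" "fin_gset G Y'"
    and h: "h = (\<lambda>H. mark G X' H - mark G Y' H)"
    using assms(2) unfolding virtual_def by blast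
  have "virtual (\<lambda>H. mark G (gset_sum (gset_prod X X') (gset_prod Y Y')) H
      - mark G (gset_sum (gset_prod X Y') (gset_prod Y X')) H)"
    using X Y by (intro virtual_diff fin_gset_sum fin_gset_prod)
  then show ?thesis
    using X Y by (simp add: mark_sum mark_prod fin_gset_prod f h algebra_simps)
qed

lemma mark_class_nonempty: "virtual f \<Longrightarrow> mark_class f \<noteq> {}"
  by (auto simp: mark_class_def virtual_def)

lemma mark_class_inj:
  assumes "virtual f" "mark_class f = mark_class h"
  shows "f = h"
proof -
  obtain X Y where "(X, Y) \<in> mark_class f" "(X, Y) \<in> mark_class h"
    using mark_class_nonempty[OF assms(1)] assms(2) by auto
  then show ?thesis
    by (auto simp: mark_class_def)
qed

lemma carrier_BR: "carrier BR = mark_class ` Collect virtual"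
proof -
  have "x \<in> mark_class ` Collect virtual \<longleftrightarrow> (\<exists>(X :: ('g, nat) gset) (Y :: ('g, nat) gset).
      x = gdiff G X Y \<and> fin_gset G X \<and> fin_gset G Y)" for x
    unfolding virtual_def image_iff Bex_def mem_Collect_eq by (metis gdiff_eq_mark_class)
  then show ?thesis
    by (simp add: burnside_ring_def set_eq_iff)
qed

text \<open>A union over representatives equals the common value only if there are representatives;
  virtual functions guarantee them. Both ring operations are evaluated this way.\<close>

lemma UN_mark_class:
  assumes "virtual f" "virtual h"
    "\<And>A B C D. fin_gset G A \<Longrightarrow> fin_gset G B \<Longrightarrow> fin_gset G C \<Longrightarrow> fin_gset G D
       \<Longrightarrow> (\<And>H. f H = mark G A H - mark G B H) \<Longrightarrow> (\<And>H. h H = mark G C H - mark G D H)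
       \<Longrightarrow> F A B C D = M"
  shows "(\<Union>(A, B) \<in> mark_class f. \<Union>(C, D) \<in> mark_class h. F A B C D) = M"
proof -
  have "F A B C D = M" if "(A, B) \<in> mark_class f" "(C, D) \<in> mark_class h" for A B C D
    using that by (intro assms(3)) (auto simp: mark_class_def)
  then have "(\<Union>(A, B) \<in> mark_class f. \<Union>(C, D) \<in> mark_class h. F A B C D)
    = (\<Union>(A, B) \<in> mark_class f. \<Union>(C, D) \<in> mark_class h. M)"
    by (intro SUP_cong refl) auto
  then show ?thesis
    using mark_class_nonempty[OF assms(1)] mark_class_nonempty[OF assms(2)] by auto
qed

lemma add_mark_class:
  assumes "virtual f" "virtual h"
  shows "mark_class f \<oplus>\<^bsub>BR\<^esub> mark_class h = mark_class (\<lambda>H. f H + h H)"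
proof -
  have "gdiff G (gset_sum A C) (gset_sum B D) = mark_class (\<lambda>H. f H + h H)"
    if fin: "fin_gset G A" "fin_gset G B" "fin_gset G C" "fin_gset G D"
      and eq: "\<And>H. f H = mark G A H - mark G B H" "\<And>H. h H = mark G C H - mark G D H"
    for A B C D :: "('g, nat) gset"
    using fin by (simp add: gdiff_eq_mark_class fin_gset_sum mark_sum eq algebra_simps)
  note * = UN_mark_class[OF assms this]
  show ?thesis
    unfolding burnside_ring_def ring.simps monoid.simps by (rule *)
qed

lemma mult_mark_class:
  assumes "virtual f" "virtual h"
  shows "mark_class f \<otimes>\<^bsub>BR\<^esub> mark_class h = mark_class (\<lambda>H. f H * h H)"
proof -
  have "gdiff G (gset_sum (gset_prod A C) (gset_prod B D)) (gset_sum (gset_prod A D) (gset_prod B C))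
      = mark_class (\<lambda>H. f H * h H)"
    if fin: "fin_gset G A" "fin_gset G B" "fin_gset G C" "fin_gset G D"
      and eq: "\<And>H. f H = mark G A H - mark G B H" "\<And>H. h H = mark G C H - mark G D H"
    for A B C D :: "('g, nat) gset"
    using fin by (simp add: gdiff_eq_mark_class fin_gset_sum fin_gset_prod mark_sum mark_prod eq
        algebra_simps)
  note * = UN_mark_class[OF assms this]
  show ?thesis
    unfolding burnside_ring_def ring.simps monoid.simps by (rule *)
qed

lemma zero_mark_class: "\<zero>\<^bsub>BR\<^esub> = mark_class (\<lambda>H. 0)"
  by (simp add: burnside_ring_def gclass_eq_mark_class fin_gset_empty mark_empty[abs_def])

lemma one_mark_class: "\<one>\<^bsub>BR\<^esub> = mark_class (\<lambda>H. 1)"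
  by (simp add: burnside_ring_def gclass_eq_mark_class fin_gset_point mark_point[abs_def])

text \<open>Every element is a \<open>mark_class\<close> of a virtual function, and the operations
  are pointwise there, so each axiom reduces to an identity of integers.\<close>

lemma cring_BR: "cring BR"
proof (rule cringI)
  show "abelian_group BR"
  proof (rule abelian_groupI)
    fix x assume "x \<in> carrier BR"
    then obtain f where f: "virtual f" "x = mark_class f"
      by (auto simp: carrier_BR)
    show "\<exists>y \<in> carrier BR. y \<oplus>\<^bsub>BR\<^esub> x = \<zero>\<^bsub>BR\<^esub>"
      by (rule bexI[of _ "mark_class (\<lambda>H. - f H)"])
        (auto simp: f carrier_BR virtual_uminus add_mark_class zero_mark_class)
  qed (auto simp: carrier_BR virtual_add virtual_0 add_mark_class zero_mark_class algebra_simps)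
  show "comm_monoid BR"
    by (rule comm_monoidI)
      (auto simp: carrier_BR virtual_mult virtual_1 mult_mark_class one_mark_class algebra_simps)
qed (auto simp: carrier_BR virtual_add virtual_mult add_mark_class mult_mark_class algebra_simps)

interpretation BR: cring BR
  by (rule cring_BR)

section \<open>The mark homomorphism to integer functions\<close>

definition chi :: "'g burnside \<Rightarrow> 'g set \<Rightarrow> int" where
  "chi p = (THE f. virtual f \<and> p = mark_class f)"

lemma chi_mark_class: "virtual f \<Longrightarrow> chi (mark_class f) = f"
  unfolding chi_def by (rule the_equality) (auto dest: mark_class_inj)

text \<open>Marks separate the elements of the ring, so equations between them can be verified one
  \<open>H\<close> at a time.\<close>

lemma chi_inject:
  assumes "p \<in> carrier BR" "q \<in> carrier BR" "\<And>H. chi p H = chi q H"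
  shows "p = q"
proof -
  obtain f h where f: "virtual f" "p = mark_class f" and h: "virtual h" "q = mark_class h"
    using assms(1,2) by (auto simp: carrier_BR)
  have "f = h"
    using assms(3) by (simp add: f h chi_mark_class fun_eq_iff)
  then show ?thesis
    by (simp add: f h)
qed

lemma gclass_closed: "fin_gset G X \<Longrightarrow> gclass G X \<in> carrier BR"
  by (auto simp: carrier_BR gclass_eq_mark_class virtual_mark)

lemma chi_gclass: "fin_gset G X \<Longrightarrow> chi (gclass G X) = mark G X"
  by (simp add: gclass_eq_mark_class chi_mark_class virtual_mark)

lemma chi_zero: "chi \<zero>\<^bsub>BR\<^esub> H = 0"
  by (simp add: zero_mark_class chi_mark_class virtual_0)

lemma chi_one: "chi \<one>\<^bsub>BR\<^esub> H = 1"
  by (simp add: one_mark_class chi_mark_class virtual_1)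

lemma chi_add: "p \<in> carrier BR \<Longrightarrow> q \<in> carrier BR \<Longrightarrow> chi (p \<oplus>\<^bsub>BR\<^esub> q) H = chi p H + chi q H"
  by (auto simp: carrier_BR chi_mark_class add_mark_class virtual_add)

lemma chi_mult: "p \<in> carrier BR \<Longrightarrow> q \<in> carrier BR \<Longrightarrow> chi (p \<otimes>\<^bsub>BR\<^esub> q) H = chi p H * chi q H"
  by (auto simp: carrier_BR chi_mark_class mult_mark_class virtual_mult)

lemma chi_minus:
  assumes "p \<in> carrier BR"
  shows "chi (\<ominus>\<^bsub>BR\<^esub> p) H = - chi p H"
  using chi_add[OF assms BR.a_inv_closed[OF assms], of H] assms by (simp add: BR.r_neg chi_zero)

lemma chi_add_pow_nat:
  assumes "p \<in> carrier BR"
  shows "chi ([(n :: nat)] \<cdot>\<^bsub>BR\<^esub> p) H = int n * chi p H"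
proof (induction n)
  case (Suc n)
  have "[Suc n] \<cdot>\<^bsub>BR\<^esub> p = [n] \<cdot>\<^bsub>BR\<^esub> p \<oplus>\<^bsub>BR\<^esub> p"
    by (rule BR.add.nat_pow_Suc)
  then show ?case
    using assms Suc by (simp add: chi_add BR.add.nat_pow_closed algebra_simps)
qed (simp add: chi_zero)

lemma chi_add_pow:
  assumes "p \<in> carrier BR"
  shows "chi ([(k :: int)] \<cdot>\<^bsub>BR\<^esub> p) H = k * chi p H"
proof (cases "0 \<le> k")
  case True
  then show ?thesis
    by (simp add: add_pow_int_ge chi_add_pow_nat assms)
next
  case False
  then show ?thesis
    by (simp add: add_pow_int_lt chi_minus chi_add_pow_nat BR.add.nat_pow_closed assms)
qed

lemma chi_finsum:
  assumes "finite I" "\<And>i. i \<in> I \<Longrightarrow> F i \<in> carrier BR"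
  shows "chi (\<Oplus>\<^bsub>BR\<^esub>i \<in> I. F i) H = (\<Sum>i \<in> I. chi (F i) H)"
  using assms
  by (induction I rule: finite_induct)
    (auto simp: chi_zero chi_add BR.finsum_insert BR.finsum_closed Pi_def)

section \<open>Power series over the Burnside ring\<close>

abbreviation PS :: "(nat \<Rightarrow> 'g burnside) ring" where "PS \<equiv> power_series BR"

text \<open>One integer series for each \<open>H\<close>: there every nonzero factor can be
  cancelled, whereas the Burnside ring generally has zero divisors.\<close>

definition chi_fps :: "'g set \<Rightarrow> (nat \<Rightarrow> 'g burnside) \<Rightarrow> int fps" where
  "chi_fps H p = Abs_fps (\<lambda>n. chi (p n) H)"

lemma PS_carrier_iff: "p \<in> carrier PS \<longleftrightarrow> (\<forall>n. p n \<in> carrier BR)"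
  by (simp add: power_series_def)

lemma chi_fps_inject:
  assumes "p \<in> carrier PS" "q \<in> carrier PS" "\<And>H. chi_fps H p = chi_fps H q"
  shows "p = q"
proof
  fix n
  have "chi (p n) H = chi (q n) H" for H
    using assms(3)[of H] by (simp add: chi_fps_def fps_eq_iff)
  then show "p n = q n"
    using assms by (intro chi_inject) (auto simp: PS_carrier_iff)
qed

lemma PS_mult_closed: "p \<in> carrier PS \<Longrightarrow> q \<in> carrier PS \<Longrightarrow> p \<otimes>\<^bsub>PS\<^esub> q \<in> carrier PS"
  by (auto simp: power_series_def intro!: BR.finsum_closed)

lemma chi_fps_mult:
  assumes "p \<in> carrier PS" "q \<in> carrier PS"
  shows "chi_fps H (p \<otimes>\<^bsub>PS\<^esub> q) = chi_fps H p * chi_fps H q"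
  using assms unfolding PS_carrier_iff
  by (simp add: chi_fps_def fps_eq_iff fps_mult_nth power_series_def chi_finsum chi_mult atLeast0AtMost)

lemma PS_one_closed: "\<one>\<^bsub>PS\<^esub> \<in> carrier PS"
  by (simp add: power_series_def)

lemma chi_fps_one: "chi_fps H \<one>\<^bsub>PS\<^esub> = 1"
  by (simp add: chi_fps_def fps_eq_iff power_series_def chi_one chi_zero)

lemma subst_neg_closed: "p \<in> carrier PS \<Longrightarrow> subst_neg BR p \<in> carrier PS"
  by (simp add: PS_carrier_iff subst_neg_def BR.add.int_pow_closed)

text \<open>The signs square to one. The inverse of sigma_t(x) is lambda at -t, and this recovers
  lambda_t from it.\<close>

lemma subst_neg_subst_neg:
  assumes "p \<in> carrier PS"
  shows "subst_neg BR (subst_neg BR p) = p"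
  using assms subst_neg_closed[OF assms] subst_neg_closed[OF subst_neg_closed[OF assms]]
  by (intro chi_fps_inject)
    (simp_all add: chi_fps_def fps_eq_iff PS_carrier_iff subst_neg_def chi_add_pow
      BR.add.int_pow_closed flip: mult.assoc power_mult_distrib)

end

section \<open>Invariant multisets and lists of disjoint invariant sets\<close>

text \<open>\<open>J\<close> is a set of labels of maps, later \<open>H \<inter> carrier G\<close>.
  These multisets then describe the \<open>H\<close>-fixed points of the symmetric power.\<close>

definition inv_msets :: "'g set \<Rightarrow> ('g \<Rightarrow> 'b \<Rightarrow> 'b) \<Rightarrow> 'b set \<Rightarrow> nat \<Rightarrow> 'b multiset set" where
  "inv_msets J a A n =
     {M. set_mset M \<subseteq> A \<and> size M = n \<and> (\<forall>g \<in> J. image_mset (a g) M = M)}"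

text \<open>The group acts on a tuple entry by entry, so a fixed tuple has every single block
  invariant.\<close>

definition inv_set_lists :: "'g set \<Rightarrow> ('g \<Rightarrow> 'b \<Rightarrow> 'b) \<Rightarrow> 'b set \<Rightarrow> nat \<Rightarrow> 'b set list set" where
  "inv_set_lists J a A n =
     {Ts. sorted_wrt (\<lambda>S T. S \<inter> T = {}) Ts \<and> (\<forall>T \<in> set Ts. T \<noteq> {} \<and> T \<subseteq> A \<and> (\<forall>g \<in> J. a g ` T = T)) \<and>
        sum_list (map card Ts) = n}"

lemma finite_msets:
  assumes "finite A"
  shows "finite {M. set_mset M \<subseteq> A \<and> size M = n}"
proof (rule finite_subset)
  show "{M. set_mset M \<subseteq> A \<and> size M = n} \<subseteq> mset ` {xs. set xs \<subseteq> A \<and> length xs = n}"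
  proof
    fix M assume M: "M \<in> {M. set_mset M \<subseteq> A \<and> size M = n}"
    obtain xs where "M = mset xs" using ex_mset by metis
    then show "M \<in> mset ` {xs. set xs \<subseteq> A \<and> length xs = n}" using M by auto
  qed
qed (simp add: assms finite_lists_length_eq)

lemma finite_inv_msets: "finite A \<Longrightarrow> finite (inv_msets J a A n)"
  by (rule finite_subset[OF _ finite_msets[of A n]]) (auto simp: inv_msets_def)

lemma finite_inv_set_lists:
  assumes "finite A"
  shows "finite (inv_set_lists J a A n)"
proof (rule finite_subset)
  have "length Ts \<le> sum_list (map card Ts)" if "\<forall>T \<in> set Ts. T \<noteq> {} \<and> T \<subseteq> A" for Ts :: "'a set list"
    using that
  proof (induction Ts)
    case (Cons T Ts)
    then have "0 < card T" using finite_subset[OF _ assms] by (auto simp: card_gt_0_iff)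
    then show ?case using Cons by simp
  qed simp
  then show "inv_set_lists J a A n \<subseteq> {Ts. set Ts \<subseteq> Pow A \<and> length Ts \<le> n}"
    by (auto simp: inv_set_lists_def)
qed (simp add: assms finite_lists_length_le)

lemma inv_msets_0: "inv_msets J a A 0 = {{#}}"
  by (auto simp: inv_msets_def)

lemma inv_set_lists_0:
  assumes "finite A"
  shows "inv_set_lists J a A 0 = {[]}"
proof -
  have "Ts = []" if "Ts \<in> inv_set_lists J a A 0" for Ts
  proof (rule ccontr)
    assume "Ts \<noteq> []"
    then obtain T where T: "T \<in> set Ts" by (meson last_in_set)
    then have "T \<noteq> {}" "finite T" "card T = 0"
      using that finite_subset[OF _ assms] by (auto simp: inv_set_lists_def sum_list_eq_0_iff)
    then show False by simp
  qed
  then show ?thesis by (auto simp: inv_set_lists_def)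
qed

text \<open>The coefficient of the claimed inverse of sigma_t(S) at one \<open>H\<close>; the sign
  (-1)^n of the theorem is left to the substitution of -t.\<close>

definition signed_count :: "'g set \<Rightarrow> ('g \<Rightarrow> 'b \<Rightarrow> 'b) \<Rightarrow> 'b set \<Rightarrow> nat \<Rightarrow> int" where
  "signed_count J a A n = (\<Sum>Ts \<in> inv_set_lists J a A n. (-1) ^ length Ts)"

text \<open>A pair \<open>(M, [T\<^sub>1, \<dots>, T\<^sub>l])\<close> is changed as follows. If \<open>U\<close>, the set of elements of \<open>M\<close> lying in
  no \<open>T\<^sub>j\<close>, is nonempty, then one copy of \<open>U\<close> is moved from \<open>M\<close> to the front of the list; otherwise
  \<open>T\<^sub>1\<close> is merged into \<open>M\<close>. The second case undoes the first, because \<open>T\<^sub>1\<close> is then exactly the set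
  of elements of \<open>M + T\<^sub>1\<close> lying in no other \<open>T\<^sub>j\<close>.\<close>

lemma signed_sum_eq_0:
  assumes fin: "finite A" and inj: "\<And>g. g \<in> J \<Longrightarrow> inj_on (a g) A" and n: "0 < n"
  defines "W \<equiv> \<Union>i \<le> n. inv_msets J a A i \<times> inv_set_lists J a A (n - i)"
  shows "(\<Sum>(M, Ts) \<in> W. (-1) ^ length Ts) = (0 :: int)"
proof -
  define U where "U M Ts = set_mset M - \<Union>(set Ts)" for M :: "'a multiset" and Ts :: "'a set list"
  have W_iff: "(M, Ts) \<in> W \<longleftrightarrow> set_mset M \<subseteq> A \<and> (\<forall>g \<in> J. image_mset (a g) M = M) \<and>
      sorted_wrt (\<lambda>S T. S \<inter> T = {}) Ts \<and> (\<forall>T \<in> set Ts. T \<noteq> {} \<and> T \<subseteq> A \<and> (\<forall>g \<in> J. a g ` T = T)) \<and>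
      size M + sum_list (map card Ts) = n" for M Ts
    unfolding W_def inv_msets_def inv_set_lists_def by auto
  have finW: "finite W"
    unfolding W_def by (intro finite_UN_I) (auto simp: finite_inv_msets finite_inv_set_lists fin)
  define P where "P = {(M, Ts) \<in> W. U M Ts \<noteq> {}}"
  define N where "N = {(M, Ts) \<in> W. U M Ts = {}}"
  have finPN: "finite P" "finite N" and PN: "P \<inter> N = {}" "W = P \<union> N"
    using finW by (auto simp: P_def N_def intro: finite_subset[OF _ finW])
  \<comment> \<open>Injectivity on \<open>A\<close> lets the image pass through the set
    difference.\<close>
  have U_inv: "a g ` U M Ts = U M Ts" if W: "(M, Ts) \<in> W" and g: "g \<in> J" for M Ts g
  proof -
    have "a g ` U M Ts = a g ` set_mset M - a g ` \<Union>(set Ts)"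
      unfolding U_def by (rule inj_on_image_set_diff[OF inj[OF g]]) (use W in \<open>auto simp: W_iff\<close>)
    also have "a g ` set_mset M = set_mset M"
      using W g by (metis W_iff set_image_mset)
    also have "a g ` \<Union>(set Ts) = \<Union>(set Ts)"
      using W g by (auto simp: W_iff image_Union)
    finally show ?thesis by (simp add: U_def)
  qed
  have msub: "mset_set (U M Ts) \<subseteq># M" for M Ts
    by (rule subset_mset.order_trans[OF subset_imp_msubset_mset_set mset_set_set_mset_msubset])
      (auto simp: U_def)
  have finU: "finite (U M Ts)" for M Ts
    by (simp add: U_def)
  let ?f = "\<lambda>(M, Ts). (M - mset_set (U M Ts), U M Ts # Ts)"
  let ?h = "\<lambda>(M, Ts). (M + mset_set (hd Ts), tl Ts)"
  have fP: "?f p \<in> N" "?h (?f p) = p" if p: "p \<in> P" for p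
  proof -
    obtain M Ts where [simp]: "p = (M, Ts)" by force
    have W: "(M, Ts) \<in> W" and ne: "U M Ts \<noteq> {}"
      using p by (auto simp: P_def)
    have "(M - mset_set (U M Ts), U M Ts # Ts) \<in> W"
      unfolding W_iff
    proof (intro conjI)
      show "set_mset (M - mset_set (U M Ts)) \<subseteq> A"
        using W by (auto simp: W_iff dest: in_diffD)
      show "\<forall>g \<in> J. image_mset (a g) (M - mset_set (U M Ts)) = M - mset_set (U M Ts)"
      proof
        fix g assume g: "g \<in> J"
        have "inj_on (a g) (U M Ts)"
          by (rule inj_on_subset[OF inj[OF g]]) (use W in \<open>auto simp: W_iff U_def\<close>)
        then show "image_mset (a g) (M - mset_set (U M Ts)) = M - mset_set (U M Ts)"
          using W g U_inv[OF W g] by (simp add: image_mset_Diff[OF msub] image_mset_mset_set W_iff)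
      qed
      show "sorted_wrt (\<lambda>S T. S \<inter> T = {}) (U M Ts # Ts)"
        using W by (auto simp: W_iff U_def)
      show "\<forall>T \<in> set (U M Ts # Ts). T \<noteq> {} \<and> T \<subseteq> A \<and> (\<forall>g \<in> J. a g ` T = T)"
        using W ne U_inv[OF W] by (auto simp: W_iff U_def)
      show "size (M - mset_set (U M Ts)) + sum_list (map card (U M Ts # Ts)) = n"
        using W size_mset_mono[OF msub[of M Ts]] by (simp add: W_iff size_Diff_submset msub)
    qed
    moreover have "U (M - mset_set (U M Ts)) (U M Ts # Ts) = {}"
      by (auto simp: U_def dest: in_diffD)
    ultimately show "?f p \<in> N"
      by (simp add: N_def)
    show "?h (?f p) = p"
      by (simp add: msub)
  qed
  have hN: "?h p \<in> P" "?f (?h p) = p" "snd p \<noteq> []" if p: "p \<in> N" for p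
  proof -
    obtain M Ts where [simp]: "p = (M, Ts)" by force
    have W: "(M, Ts) \<in> W" and sub: "set_mset M \<subseteq> \<Union>(set Ts)"
      using p by (auto simp: N_def U_def)
    \<comment> \<open>Here \<open>0 < n\<close> enters: an empty list would force \<open>M\<close>
      to be empty too, so the total size would be zero.\<close>
    have "Ts \<noteq> []"
      using W sub n by (auto simp: W_iff)
    then obtain T Rs where Ts: "Ts = T # Rs" by (cases Ts) auto
    have finT: "finite T" and T: "T \<subseteq> A" "T \<noteq> {}" "\<And>g. g \<in> J \<Longrightarrow> a g ` T = T"
      and disj: "T \<inter> \<Union>(set Rs) = {}"
      using W finite_subset[OF _ fin] by (auto simp: W_iff Ts)
    have "(M + mset_set T, Rs) \<in> W"
      unfolding W_iff
    proof (intro conjI)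
      show "\<forall>g \<in> J. image_mset (a g) (M + mset_set T) = M + mset_set T"
        using W T(3) inj_on_subset[OF inj T(1)] by (auto simp: W_iff image_mset_mset_set)
    qed (use W finT T in \<open>auto simp: W_iff Ts\<close>)
    moreover have U: "U (M + mset_set T) Rs = T"
      using sub disj finT by (auto simp: U_def Ts)
    ultimately show "?h p \<in> P"
      using T(2) by (simp add: P_def Ts)
    show "?f (?h p) = p"
      by (simp add: Ts U)
    show "snd p \<noteq> []"
      by (simp add: Ts)
  qed
  have "(\<Sum>(M, Ts) \<in> P. (-1) ^ length Ts) = (\<Sum>(M, Ts) \<in> N. - ((-1) ^ length Ts) :: int)"
    by (rule sum.reindex_bij_witness[of P ?h ?f]) (use fP hN in auto)
  moreover have "(\<Sum>(M, Ts) \<in> W. (-1) ^ length Ts :: int)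
      = (\<Sum>(M, Ts) \<in> P. (-1) ^ length Ts) + (\<Sum>(M, Ts) \<in> N. (-1) ^ length Ts)"
    unfolding PN(2) by (rule sum.union_disjoint[OF finPN PN(1)])
  ultimately show ?thesis
    by (simp add: sum_negf case_prod_unfold)
qed

text \<open>The coefficient of t^n in sigma_t(S) times its claimed inverse. Pairs for different
  \<open>i\<close> are disjoint because \<open>i\<close> is the size of the multiset, so the
  convolution is one signed sum over all pairs.\<close>

lemma inv_msets_signed_count_convolution:
  assumes fin: "finite A" and inj: "\<And>g. g \<in> J \<Longrightarrow> inj_on (a g) A"
  shows "(\<Sum>i \<le> n. int (card (inv_msets J a A i)) * signed_count J a A (n - i)) = (if n = 0 then 1 else 0)"
proof (cases "n = 0")
  case True
  then show ?thesis
    by (simp add: inv_msets_0 signed_count_def inv_set_lists_0 fin)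
next
  case False
  have "(\<Sum>i \<le> n. int (card (inv_msets J a A i)) * signed_count J a A (n - i))
      = (\<Sum>i \<le> n. \<Sum>(M, Ts) \<in> inv_msets J a A i \<times> inv_set_lists J a A (n - i). (-1) ^ length Ts)"
    by (simp add: signed_count_def flip: sum.cartesian_product)
  also have "\<dots> = (\<Sum>(M, Ts) \<in> (\<Union>i \<le> n. inv_msets J a A i \<times> inv_set_lists J a A (n - i)). (-1) ^ length Ts)"
    by (rule sum.UNION_disjoint[symmetric])
      (auto simp: finite_inv_msets finite_inv_set_lists fin, auto simp: inv_msets_def)
  also have "\<dots> = 0"
    by (rule signed_sum_eq_0[OF fin inj]) (use False in auto)
  finally show ?thesis
    using False by simp
qed


subsection \<open>Disjoint unions and transport\<close>

lemma mset_sum_decomp: "\<exists>M N. L = image_mset Inl M + image_mset Inr N"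
proof (induction L)
  case (add x L)
  then obtain M N where L: "L = image_mset Inl M + image_mset Inr N" by blast
  show ?case
  proof (cases x)
    case (Inl y)
    then show ?thesis by (intro exI[of _ "add_mset y M"] exI[of _ N]) (simp add: L)
  next
    case (Inr y)
    then show ?thesis by (intro exI[of _ M] exI[of _ "add_mset y N"]) (simp add: L)
  qed
qed simp

lemma count_image_mset_Inl_Inr:
  "count (image_mset Inl M) (Inl x) = count M x" "count (image_mset Inl M) (Inr y) = 0"
  "count (image_mset Inr N) (Inr y) = count N y" "count (image_mset Inr N) (Inl x) = 0"
  by (induction M, auto) (induction N, auto)+

lemma mset_sum_inject:
  fixes M M' :: "'a multiset" and N N' :: "'b multiset"
  shows
  "image_mset Inl M + image_mset Inr N = image_mset Inl M' + image_mset Inr N' \<longleftrightarrow> M = M' \<and> N = N'"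
proof
  assume eq: "image_mset Inl M + image_mset Inr N = image_mset Inl M' + image_mset Inr N'"
  have "count (image_mset Inl M + image_mset Inr N) (Inl x) = count M x" for M N and x :: 'a
    by (simp add: count_image_mset_Inl_Inr)
  moreover have "count (image_mset Inl M + image_mset Inr N) (Inr y) = count N y" for M N and y :: 'b
    by (simp add: count_image_mset_Inl_Inr)
  ultimately have "count M x = count M' x" "count N y = count N' y" for x y
    using eq by metis+
  then show "M = M' \<and> N = N'"
    by (simp add: multiset_eq_iff)
qed simp

text \<open>A multiset on a disjoint union splits uniquely into its two sides, which the action does
  not mix; invariance is therefore a condition on each side. In terms of marks this is sigma_t(X +
  Y) = sigma_t(X) sigma_t(Y).\<close>

lemma card_inv_msets_sum:
  fixes a :: "'g \<Rightarrow> 'b \<Rightarrow> 'b" and b :: "'g \<Rightarrow> 'c \<Rightarrow> 'c"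
  assumes fin: "finite A" "finite B"
  shows "card (inv_msets J (\<lambda>g. map_sum (a g) (b g)) (A <+> B) n)
    = (\<Sum>i \<le> n. card (inv_msets J a A i) * card (inv_msets J b B (n - i)))"
proof -
  let ?F = "\<lambda>(M, N). image_mset Inl M + image_mset Inr N"
  let ?W = "\<Union>i \<le> n. inv_msets J a A i \<times> inv_msets J b B (n - i)"
  have act: "image_mset (map_sum f h) (image_mset Inl M + image_mset Inr N)
    = image_mset Inl (image_mset f M) + image_mset Inr (image_mset h N)"
    for f :: "'b \<Rightarrow> 'b" and h :: "'c \<Rightarrow> 'c" and M N
    by (simp add: multiset.map_comp o_def)
  have fixed: "image_mset (map_sum f h) (image_mset Inl M + image_mset Inr N)
      = image_mset Inl M + image_mset Inr N \<longleftrightarrow> image_mset f M = M \<and> image_mset h N = N"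
    for f :: "'b \<Rightarrow> 'b" and h :: "'c \<Rightarrow> 'c" and M N
    unfolding act mset_sum_inject ..
  have mem: "image_mset Inl M + image_mset Inr N \<in> inv_msets J (\<lambda>g. map_sum (a g) (b g)) (A <+> B) n
      \<longleftrightarrow> (M, N) \<in> ?W" for M N
    unfolding inv_msets_def mem_Collect_eq fixed by auto
  have "inj_on ?F ?W"
    by (rule inj_onI) (auto simp: mset_sum_inject)
  moreover have "?F ` ?W = inv_msets J (\<lambda>g. map_sum (a g) (b g)) (A <+> B) n"
  proof (intro equalityI subsetI)
    fix L assume L: "L \<in> inv_msets J (\<lambda>g. map_sum (a g) (b g)) (A <+> B) n"
    obtain M N where "L = ?F (M, N)" using mset_sum_decomp[of L] by auto
    then show "L \<in> ?F ` ?W"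
      using L mem[of M N] by (auto intro!: image_eqI[of _ ?F "(M, N)"])
  next
    fix L assume "L \<in> ?F ` ?W"
    then obtain p where p: "p \<in> ?W" "L = ?F p"
      by (rule imageE)
    then show "L \<in> inv_msets J (\<lambda>g. map_sum (a g) (b g)) (A <+> B) n"
      using mem[of "fst p" "snd p"] by (simp only: prod.collapse case_prod_unfold)
  qed
  ultimately have "card (inv_msets J (\<lambda>g. map_sum (a g) (b g)) (A <+> B) n) = card ?W"
    using card_image[of ?F ?W] by simp
  also have "\<dots> = (\<Sum>i \<le> n. card (inv_msets J a A i \<times> inv_msets J b B (n - i)))"
    by (rule card_UN_disjoint) (auto simp: finite_inv_msets fin, auto simp: inv_msets_def)
  finally show ?thesis
    by (simp add: card_cartesian_product)
qed

text \<open>Only an inequality, for an injective equivariant map: applied to an isomorphism and to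
  its inverse it gives equality.\<close>

lemma card_inv_msets_le:
  assumes fin: "finite B" and inj: "inj_on f A" "f ` A \<subseteq> B"
    and equiv: "\<And>g x. g \<in> J \<Longrightarrow> x \<in> A \<Longrightarrow> f (a g x) = b g (f x)"
  shows "card (inv_msets J a A n) \<le> card (inv_msets J b B n)"
proof (rule card_inj_on_le)
  have "image_mset (the_inv_into A f) (image_mset f M) = M" if "set_mset M \<subseteq> A" for M
  proof -
    have "image_mset (the_inv_into A f \<circ> f) M = image_mset id M"
      by (rule image_mset_cong) (use that the_inv_into_f_f[OF inj(1)] in auto)
    then show ?thesis by (simp add: multiset.map_comp)
  qed
  then show "inj_on (image_mset f) (inv_msets J a A n)"
    by (intro inj_on_inverseI[where g = "image_mset (the_inv_into A f)"]) (auto simp: inv_msets_def)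
  have "image_mset (b g) (image_mset f M) = image_mset f (image_mset (a g) M)"
    if "set_mset M \<subseteq> A" "g \<in> J" for M g
    unfolding multiset.map_comp by (rule image_mset_cong) (use that equiv in auto)
  then show "image_mset f ` inv_msets J a A n \<subseteq> inv_msets J b B n"
    by (auto simp: inv_msets_def intro!: subsetD[OF inj(2)] imageI)
qed (rule finite_inv_msets[OF fin])

subsection \<open>From compositions to partitions\<close>

definition inv_tuples :: "'g set \<Rightarrow> ('g \<Rightarrow> 'b \<Rightarrow> 'b) \<Rightarrow> 'b set \<Rightarrow> nat list \<Rightarrow> 'b set list set" where
  "inv_tuples J a A c = {Ts \<in> set_tuples c A. \<forall>g \<in> J. map (image (a g)) Ts = Ts}"

text \<open>Disjointness is symmetric, so demanding it for ordered positions is demanding it for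
  all. The list form suits prepending a block, the indexed form suits permuting the blocks.\<close>

lemma sorted_wrt_disjoint_iff:
  "sorted_wrt (\<lambda>S T. S \<inter> T = {}) Ts \<longleftrightarrow>
     (\<forall>j < length Ts. \<forall>k < length Ts. j \<noteq> k \<longrightarrow> Ts ! j \<inter> Ts ! k = {})"
  (is "?L \<longleftrightarrow> ?R")
proof
  assume L: ?L
  have "Ts ! j \<inter> Ts ! k = {}" if "j < length Ts" "k < length Ts" "j \<noteq> k" for j k
  proof (cases "j < k")
    case True
    then show ?thesis using L that by (simp add: sorted_wrt_iff_nth_less)
  next
    case False
    then have "Ts ! k \<inter> Ts ! j = {}"
      using L that by (simp add: sorted_wrt_iff_nth_less)
    then show ?thesis by blast
  qed
  then show ?R by blast
qed (simp add: sorted_wrt_iff_nth_less)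

lemma set_tuples_alt:
  "Ts \<in> set_tuples c A \<longleftrightarrow>
     map card Ts = c \<and> (\<forall>T \<in> set Ts. T \<subseteq> A) \<and> sorted_wrt (\<lambda>S T. S \<inter> T = {}) Ts"
proof (cases "length Ts = length c")
  case True
  then show ?thesis
    unfolding set_tuples_def sorted_wrt_disjoint_iff
    by (simp add: list_eq_iff_nth_eq all_set_conv_all_nth) blast
qed (auto simp: set_tuples_def)

lemma finite_set_tuples:
  assumes "finite A"
  shows "finite (set_tuples c A)"
proof (rule finite_subset)
  show "set_tuples c A \<subseteq> {Ts. set Ts \<subseteq> Pow A \<and> length Ts = length c}"
    by (auto simp: set_tuples_alt) blast
qed (simp add: finite_lists_length_eq assms)

lemma finite_inv_tuples: "finite A \<Longrightarrow> finite (inv_tuples J a A c)"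
  by (simp add: inv_tuples_def finite_set_tuples)

text \<open>Positive parts force the blocks to be nonempty, as \<open>inv_set_lists\<close>
  demands.\<close>

lemma inv_tuples_iff:
  assumes "\<forall>m \<in> set c. 0 < m"
  shows "Ts \<in> inv_tuples J a A c \<longleftrightarrow> Ts \<in> inv_set_lists J a A (sum_list c) \<and> map card Ts = c"
proof -
  have map_iff: "map (image (a g)) Ts = Ts \<longleftrightarrow> (\<forall>T \<in> set Ts. a g ` T = T)" for g
    using map_eq_conv[of "image (a g)" Ts id] by simp
  have ne: "T \<noteq> {}" if "T \<in> set Ts" "map card Ts = c" for T
  proof -
    have "0 < card T"
      using assms that by auto
    then show ?thesis by auto
  qed
  show ?thesis
  proof (cases "map card Ts = c")
    case True
    then show ?thesis
      using ne unfolding inv_tuples_def inv_set_lists_def mem_Collect_eq set_tuples_alt map_iff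
      by simp blast
  qed (simp add: inv_tuples_def set_tuples_alt)
qed

text \<open>A permutation turning \<open>c\<close> into \<open>d\<close> also permutes the blocks of
  a tuple, and this commutes with the entrywise action. Exchanging \<open>c\<close> and
  \<open>d\<close> yields the reverse inequality.\<close>

lemma card_inv_tuples_le:
  fixes a :: "'g \<Rightarrow> 'b \<Rightarrow> 'b"
  assumes A: "finite A" and eq: "mset c = mset d"
  shows "card (inv_tuples J a A c) \<le> card (inv_tuples J a A d)"
proof -
  obtain p where p: "p permutes {..<length c}" and d: "permute_list p c = d"
    using mset_eq_permutation[OF eq[symmetric]] .
  have len: "length Ts = length c" if "Ts \<in> inv_tuples J a A c" for Ts
    using that by (simp add: inv_tuples_def set_tuples_def)
  have inv: "permute_list (Hilbert_Choice.inv p) (permute_list p Ts) = Ts"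
    if "length Ts = length c" for Ts :: "'b set list"
    using permute_list_compose[of "Hilbert_Choice.inv p" Ts p] permutes_inv[OF p] permutes_inv_o[OF p] that
    by simp
  show ?thesis
  proof (rule card_inj_on_le)
    show "inj_on (permute_list p) (inv_tuples J a A c)"
      by (rule inj_on_inverseI[where g = "permute_list (Hilbert_Choice.inv p)"]) (rule inv[OF len])
    show "permute_list p ` inv_tuples J a A c \<subseteq> inv_tuples J a A d"
    proof (rule image_subsetI)
      fix Ts assume Ts: "Ts \<in> inv_tuples J a A c"
      have p': "p permutes {..<length Ts}"
        using p len[OF Ts] by simp
      have "permute_list p Ts ! j \<inter> permute_list p Ts ! k = {}"
        if "j < length Ts" "k < length Ts" "j \<noteq> k" for j k
      proof -
        have "p j < length Ts" "p k < length Ts" "p j \<noteq> p k"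
          using permutes_in_image[OF p'] permutes_inj[OF p'] that by (auto simp: inj_eq)
        then show ?thesis
          using Ts that
          by (simp add: permute_list_nth[OF p'] inv_tuples_def set_tuples_alt sorted_wrt_disjoint_iff)
      qed
      then have "sorted_wrt (\<lambda>S T. S \<inter> T = {}) (permute_list p Ts)"
        by (simp add: sorted_wrt_disjoint_iff)
      moreover have "map (image (a g)) (permute_list p Ts) = permute_list p (map (image (a g)) Ts)" for g
        by (simp add: permute_list_map[OF p'])
      ultimately show "permute_list p Ts \<in> inv_tuples J a A d"
        using Ts d by (auto simp: inv_tuples_def set_tuples_alt set_permute_list[OF p']
            permute_list_map[OF p', symmetric])
    qed
  qed (rule finite_inv_tuples[OF A])
qed

lemma card_inv_tuples_cong:
  "finite A \<Longrightarrow> mset c = mset d \<Longrightarrow> card (inv_tuples J a A c) = card (inv_tuples J a A d)"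
  by (intro antisym card_inv_tuples_le) auto

lemma finite_partitions: "finite (partitions n)"
proof (rule finite_subset)
  have "length \<mu> \<le> sum_list \<mu>" if "\<forall>m \<in> set \<mu>. 0 < m" for \<mu> :: "nat list"
    using that by (induction \<mu>) auto
  then show "partitions n \<subseteq> {\<mu>. set \<mu> \<subseteq> {..n} \<and> length \<mu> \<le> n}"
    by (auto simp: partitions_def member_le_sum_list)
qed (simp add: finite_lists_length_le)

lemma distinct_remdups_adj_sorted:
  "sorted_wrt (\<ge>) xs \<Longrightarrow> distinct (remdups_adj xs)" for xs :: "nat list"
  by (induction xs rule: remdups_adj.induct) (auto simp: antisym)

text \<open>This explains the coefficient in the theorem: it is the number of compositions whose
  parts sort to \<mu>.\<close>

lemma multinomial_multiplicities:
  assumes "sorted_wrt (\<ge>) \<mu>"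
  shows "multinomial (length \<mu>) (multiplicities \<mu>) = card (permutations_of_multiset (mset \<mu>))"
proof -
  \<comment> \<open>Equal parts are adjacent, so \<open>remdups_adj\<close> lists every distinct
    part once and the product may run over the set of parts.\<close>
  have "(\<Prod>x \<in> set \<mu>. fact (count_list \<mu> x) :: nat) = prod_list (map fact (multiplicities \<mu>))"
    using prod.distinct_set_conv_list[OF distinct_remdups_adj_sorted[OF assms],
        of "\<lambda>x. fact (count_list \<mu> x) :: nat"]
    by (simp add: multiplicities_def o_def)
  then show ?thesis
    by (simp add: multinomial_def card_permutations_of_multiset count_mset)
qed

text \<open>The lists are grouped by their sorted block sizes. The fibre over \<mu> is the disjoint
  union of the invariant tuples for the rearrangements of \<mu>, and all rearrangements contribute
  equally many.\<close>

lemma signed_count_partitions: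
  fixes a :: "'g \<Rightarrow> 'b \<Rightarrow> 'b"
  assumes A: "finite A"
  shows "signed_count J a A n = (\<Sum>\<mu> \<in> partitions n.
    (-1) ^ length \<mu> * int (multinomial (length \<mu>) (multiplicities \<mu>)) * int (card (inv_tuples J a A \<mu>)))"
proof -
  let ?type = "\<lambda>Ts :: 'b set list. rev (sort (map card Ts))"
  let ?L = "inv_set_lists J a A n"
  have "?type ` ?L \<subseteq> partitions n"
  proof (rule image_subsetI)
    fix Ts assume Ts: "Ts \<in> ?L"
    have "sorted_wrt (\<ge>) (?type Ts)"
      by (simp add: sorted_wrt_rev)
    moreover have "\<forall>m \<in> set (?type Ts). 0 < m"
      using Ts finite_subset[OF _ A] by (auto simp: inv_set_lists_def card_gt_0_iff)
    moreover have "sum_list (?type Ts) = n"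
      using Ts by (simp add: inv_set_lists_def flip: sum_mset_sum_list)
    ultimately show "?type Ts \<in> partitions n"
      by (simp add: partitions_def)
  qed
  from sum.group[OF finite_inv_set_lists[OF A] finite_partitions this, symmetric]
  have "signed_count J a A n
      = (\<Sum>\<mu> \<in> partitions n. \<Sum>Ts \<in> {Ts \<in> ?L. ?type Ts = \<mu>}. (-1) ^ length Ts)"
    unfolding signed_count_def .
  also have "\<dots> = (\<Sum>\<mu> \<in> partitions n. (-1) ^ length \<mu> *
      int (multinomial (length \<mu>) (multiplicities \<mu>)) * int (card (inv_tuples J a A \<mu>)))"
  proof (rule sum.cong[OF refl])
    fix \<mu> assume \<mu>: "\<mu> \<in> partitions n"
    have type_iff: "?type Ts = \<mu> \<longleftrightarrow> mset (map card Ts) = mset \<mu>" for Ts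
    proof
      assume "mset (map card Ts) = mset \<mu>"
      moreover have "sorted (rev \<mu>)"
        using \<mu> by (simp add: partitions_def sorted_wrt_rev)
      ultimately have "sort (map card Ts) = rev \<mu>"
        by (intro properties_for_sort) simp_all
      then show "?type Ts = \<mu>"
        by simp
    qed auto
    have mem_iff: "Ts \<in> inv_tuples J a A c \<longleftrightarrow> Ts \<in> ?L \<and> map card Ts = c" if "mset c = mset \<mu>" for c Ts
    proof -
      have "\<forall>m \<in> set c. 0 < m"
        using \<mu> mset_eq_setD[OF that] by (simp add: partitions_def)
      moreover have "sum_list c = n"
        using \<mu> that by (metis (mono_tags, lifting) mem_Collect_eq partitions_def sum_mset_sum_list)
      ultimately show ?thesis
        using inv_tuples_iff by blast
    qed
    have fiber: "{Ts \<in> ?L. ?type Ts = \<mu>} = (\<Union>c \<in> permutations_of_multiset (mset \<mu>). inv_tuples J a A c)"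
      unfolding type_iff using mem_iff by (auto simp: permutations_of_multiset_def)
    have "card {Ts \<in> ?L. ?type Ts = \<mu>}
        = (\<Sum>c \<in> permutations_of_multiset (mset \<mu>). card (inv_tuples J a A c))"
      unfolding fiber
      by (rule card_UN_disjoint) (auto simp: finite_inv_tuples A mem_iff dest!: permutations_of_multisetD)
    also have "\<dots> = (\<Sum>c \<in> permutations_of_multiset (mset \<mu>). card (inv_tuples J a A \<mu>))"
      by (rule sum.cong[OF refl], rule card_inv_tuples_cong[OF A]) (simp add: permutations_of_multiset_def)
    also have "\<dots> = multinomial (length \<mu>) (multiplicities \<mu>) * card (inv_tuples J a A \<mu>)"
      using \<mu> by (simp add: multinomial_multiplicities partitions_def)
    finally have card: "card {Ts \<in> ?L. ?type Ts = \<mu>}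
      = multinomial (length \<mu>) (multiplicities \<mu>) * card (inv_tuples J a A \<mu>)" .
    have "length Ts = length \<mu>" if "?type Ts = \<mu>" for Ts
      using that by auto
    then have "(\<Sum>Ts \<in> {Ts \<in> ?L. ?type Ts = \<mu>}. (-1) ^ length Ts)
      = (\<Sum>Ts \<in> {Ts \<in> ?L. ?type Ts = \<mu>}. (-1) ^ length \<mu> :: int)"
      by (intro sum.cong) auto
    then show "(\<Sum>Ts \<in> {Ts \<in> ?L. ?type Ts = \<mu>}. (-1) ^ length Ts) = (-1) ^ length \<mu> *
      int (multinomial (length \<mu>) (multiplicities \<mu>)) * int (card (inv_tuples J a A \<mu>))"
      by (simp add: card)
  qed
  finally show ?thesis .
qed


section \<open>Symmetric powers and the lambda-structure\<close>

lemma perm_rel_class: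
  assumes "xs \<in> tuples n A"
  shows "perm_rel n A `` {xs} = permutations_of_multiset (mset xs)"
proof (intro equalityI subsetI)
  fix ys assume "ys \<in> perm_rel n A `` {xs}"
  then obtain p where "p permutes {..<length xs}" "ys = permute_list p xs"
    using assms by (auto simp: perm_rel_def tuples_def)
  then show "ys \<in> permutations_of_multiset (mset xs)"
    by (simp add: permutations_of_multiset_def)
next
  fix ys assume "ys \<in> permutations_of_multiset (mset xs)"
  then have "mset ys = mset xs"
    by (simp add: permutations_of_multiset_def)
  from mset_eq_permutation[OF this] obtain p
    where "p permutes {..<length xs}" "permute_list p xs = ys" .
  then show "ys \<in> perm_rel n A `` {xs}"
    using assms by (auto simp: perm_rel_def tuples_def)
qed

text \<open>An orbit of tuples consists of all orderings of one multiset, which identifies the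
  quotient with the multisets of size \<open>n\<close>.\<close>

lemma tuples_quotient:
  "tuples n A // perm_rel n A = permutations_of_multiset ` {M. set_mset M \<subseteq> A \<and> size M = n}"
proof -
  have "tuples n A // perm_rel n A = (\<lambda>xs. permutations_of_multiset (mset xs)) ` tuples n A"
    unfolding quotient_def by (auto simp: perm_rel_class)
  also have "\<dots> = permutations_of_multiset ` mset ` tuples n A"
    by (simp add: image_image)
  also have "mset ` tuples n A = {M. set_mset M \<subseteq> A \<and> size M = n}"
  proof (intro equalityI subsetI)
    fix M assume M: "M \<in> {M. set_mset M \<subseteq> A \<and> size M = n}"
    obtain xs where "mset xs = M" using ex_mset by blast
    with M show "M \<in> mset ` tuples n A"
      by (auto simp: tuples_def)
  qed (auto simp: tuples_def)
  finally show ?thesis .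
qed

lemma permutations_of_multiset_inject:
  "permutations_of_multiset M = permutations_of_multiset N \<longleftrightarrow> M = N"
proof
  assume eq: "permutations_of_multiset M = permutations_of_multiset N"
  obtain xs where "mset xs = M"
    using ex_mset by blast
  then show "M = N"
    using eq by (auto simp: permutations_of_multiset_def)
qed simp

context burnside_group
begin

lemma sym_power_restr:
  "sym_power n X = restr_action (permutations_of_multiset ` {M. set_mset M \<subseteq> fst X \<and> size M = n})
     (\<lambda>g. image (map (snd X g)))"
  by (simp add: sym_power_def tuples_quotient restr_action_def)

lemma fin_gset_sym_power:
  assumes "fin_gset G X"
  shows "fin_gset G (sym_power n X)"
  unfolding sym_power_restr
proof (rule fin_gset_restr_action)
  let ?P = "permutations_of_multiset ` {M. set_mset M \<subseteq> fst X \<and> size M = n}"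
  show "finite ?P"
    by (intro finite_imageI finite_msets fin_gset_finite assms)
  fix C assume "C \<in> ?P"
  then obtain M where M: "set_mset M \<subseteq> fst X" "size M = n" and C: "C = permutations_of_multiset M"
    by blast
  show "map (snd X g) ` C \<in> ?P" if "g \<in> carrier G" for g
    unfolding C permutations_of_multiset_image[symmetric]
    by (rule imageI) (use M fin_gset_closed[OF assms that] in auto)
  have "image_mset (snd X \<one>) M = image_mset id M"
    by (rule image_mset_cong) (use M fin_gset_one[OF assms] in auto)
  then show "map (snd X \<one>) ` C = C"
    unfolding C permutations_of_multiset_image[symmetric] by simp
  show "map (snd X (g \<otimes> h)) ` C = map (snd X g) ` map (snd X h) ` C"
    if "g \<in> carrier G" "h \<in> carrier G" for g h
    unfolding C permutations_of_multiset_image[symmetric] permutations_of_multiset_inject multiset.map_comp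
    by (rule image_mset_cong) (use M fin_gset_mult[OF assms that] in auto)
qed

text \<open>An orbit may be fixed as a whole while group elements rearrange the tuples inside it; by
  \<open>permutations_of_multiset_image\<close> this amounts to invariance of its multiset.\<close>

lemma mark_sym_power:
  "mark G (sym_power n X) H = int (card (inv_msets (H \<inter> carrier G) (snd X) (fst X) n))"
proof -
  have "{C \<in> permutations_of_multiset ` {M. set_mset M \<subseteq> fst X \<and> size M = n}.
      \<forall>g \<in> H \<inter> carrier G. map (snd X g) ` C = C}
    = permutations_of_multiset ` inv_msets (H \<inter> carrier G) (snd X) (fst X) n"
  proof -
    have "map k ` permutations_of_multiset M = permutations_of_multiset M \<longleftrightarrow> image_mset k M = M"
      for k :: "'a \<Rightarrow> 'a" and M
      unfolding permutations_of_multiset_image[symmetric] permutations_of_multiset_inject ..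
    moreover have "{C \<in> f ` B. Q C} = f ` {M \<in> B. Q (f M)}"
      for f :: "'a multiset \<Rightarrow> 'a list set" and B Q
      by auto
    ultimately show ?thesis
      unfolding inv_msets_def by simp
  qed
  moreover have "inj_on permutations_of_multiset (inv_msets (H \<inter> carrier G) (snd X) (fst X) n)"
    by (simp add: inj_on_def permutations_of_multiset_inject)
  ultimately show ?thesis
    unfolding sym_power_restr mark_restr_action
    by (simp add: card_image)
qed

lemma gset_tuples_restr:
  "gset_tuples \<mu> X = restr_action (set_tuples \<mu> (fst X)) (\<lambda>g. map (image (snd X g)))"
  by (simp add: gset_tuples_def restr_action_def)

lemma fin_gset_tuples:
  assumes "fin_gset G X"
  shows "fin_gset G (gset_tuples \<mu> X)"
  unfolding gset_tuples_restr
proof (rule fin_gset_restr_action)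
  show "finite (set_tuples \<mu> (fst X))"
    by (intro finite_set_tuples fin_gset_finite assms)
  fix Ts assume Ts: "Ts \<in> set_tuples \<mu> (fst X)"
  have sub: "T \<subseteq> fst X" if "T \<in> set Ts" for T
    using Ts that by (simp add: set_tuples_alt)
  show "map (image (snd X g)) Ts \<in> set_tuples \<mu> (fst X)" if g: "g \<in> carrier G" for g
  proof -
    have inj: "inj_on (snd X g) (fst X)"
      by (rule fin_gset_inj[OF assms g])
    have sorted: "sorted_wrt (\<lambda>S T. S \<inter> T = {}) Ts"
      using Ts unfolding set_tuples_alt by blast
    have "snd X g ` S \<inter> snd X g ` T = {}" if "S \<in> set Ts" "T \<in> set Ts" "S \<inter> T = {}" for S T
      using inj_on_image_Int[OF inj sub[OF that(1)] sub[OF that(2)]] that(3) by simp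
    then have "sorted_wrt (\<lambda>S T. S \<inter> T = {}) (map (image (snd X g)) Ts)"
      unfolding sorted_wrt_map
      by (rule sorted_wrt_mono_rel) (use Ts sorted in auto)
    moreover have "card (snd X g ` T) = card T" if "T \<in> set Ts" for T
      by (rule card_image[OF inj_on_subset[OF inj sub[OF that]]])
    moreover have "snd X g ` T \<subseteq> fst X" if "T \<in> set Ts" for T
      using sub[OF that] fin_gset_closed[OF assms g] by auto
    ultimately show ?thesis
      using Ts by (auto simp: set_tuples_alt)
  qed
  show "map (image (snd X \<one>)) Ts = Ts"
  proof (rule map_idI)
    fix T assume "T \<in> set Ts"
    then have "snd X \<one> ` T = id ` T"
      by (intro image_cong refl) (use sub fin_gset_one[OF assms] in auto)
    then show "snd X \<one> ` T = T" by simp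
  qed
  show "map (image (snd X (g \<otimes> h))) Ts = map (image (snd X g)) (map (image (snd X h)) Ts)"
    if gh: "g \<in> carrier G" "h \<in> carrier G" for g h
    unfolding map_map
  proof (rule map_cong[OF refl])
    fix T assume "T \<in> set Ts"
    then show "snd X (g \<otimes> h) ` T = (image (snd X g) \<circ> image (snd X h)) T"
      unfolding o_def image_image
      by (intro image_cong[OF refl] fin_gset_mult[OF assms gh]) (use sub in blast)
  qed
qed

lemma mark_gset_tuples:
  "mark G (gset_tuples \<mu> X) H = int (card (inv_tuples (H \<inter> carrier G) (snd X) (fst X) \<mu>))"
  unfolding gset_tuples_restr mark_restr_action inv_tuples_def ..

interpretation BR: cring BR
  by (rule cring_BR)

section \<open>Symmetric power series and their inverses\<close>

definition sym_series :: "('g, 'b) gset \<Rightarrow> nat \<Rightarrow> 'g burnside" where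
  "sym_series X n = gclass G (sym_power n X)"

text \<open>The coefficients of lambda at -t: the formula of the theorem without its factor
  (-1)^n.\<close>

definition tuple_series :: "('g, 'b) gset \<Rightarrow> nat \<Rightarrow> 'g burnside" where
  "tuple_series X n = (\<Oplus>\<^bsub>BR\<^esub> \<mu> \<in> partitions n.
     [((-1) ^ length \<mu> * int (multinomial (length \<mu>) (multiplicities \<mu>)))]
       \<cdot>\<^bsub>BR\<^esub> gclass G (gset_tuples \<mu> X))"

lemma sym_series_closed: "fin_gset G X \<Longrightarrow> sym_series X \<in> carrier PS"
  by (simp add: PS_carrier_iff sym_series_def gclass_closed fin_gset_sym_power)

lemma tuple_series_closed: "fin_gset G X \<Longrightarrow> tuple_series X \<in> carrier PS"
  by (auto simp: PS_carrier_iff tuple_series_def gclass_closed fin_gset_tuples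
      intro!: BR.finsum_closed BR.add.int_pow_closed)

lemma chi_sym_series:
  "fin_gset G X \<Longrightarrow>
    chi (sym_series X n) H = int (card (inv_msets (H \<inter> carrier G) (snd X) (fst X) n))"
  by (simp add: sym_series_def chi_gclass fin_gset_sym_power mark_sym_power)

lemma chi_tuple_series:
  assumes "fin_gset G X"
  shows "chi (tuple_series X n) H = signed_count (H \<inter> carrier G) (snd X) (fst X) n"
  unfolding tuple_series_def
  by (subst chi_finsum)
    (auto simp: finite_partitions gclass_closed fin_gset_tuples assms BR.add.int_pow_closed
      chi_add_pow chi_gclass mark_gset_tuples signed_count_partitions fin_gset_finite)

text \<open>Besides inverting sigma_t(X), this shows that its series is nonzero at every
  \<open>H\<close>, the basis of all later cancellations.\<close>

lemma sym_series_mult_tuple_series: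
  assumes "fin_gset G X"
  shows "chi_fps H (sym_series X) * chi_fps H (tuple_series X) = 1"
proof -
  have "inj_on (snd X g) (fst X)" if "g \<in> H \<inter> carrier G" for g
    using fin_gset_inj[OF assms] that by blast
  then have conv: "(\<Sum>i \<le> n. int (card (inv_msets (H \<inter> carrier G) (snd X) (fst X) i)) *
      signed_count (H \<inter> carrier G) (snd X) (fst X) (n - i)) = (if n = 0 then 1 else 0)" for n
    by (rule inv_msets_signed_count_convolution[OF fin_gset_finite[OF assms]])
  show ?thesis
  proof (rule fps_ext)
    fix n
    have "fps_nth (chi_fps H (sym_series X) * chi_fps H (tuple_series X)) n
      = (\<Sum>i \<le> n. int (card (inv_msets (H \<inter> carrier G) (snd X) (fst X) i)) *
          signed_count (H \<inter> carrier G) (snd X) (fst X) (n - i))"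
      by (simp add: fps_mult_nth chi_fps_def chi_sym_series chi_tuple_series assms atLeast0AtMost)
    then show "fps_nth (chi_fps H (sym_series X) * chi_fps H (tuple_series X)) n = fps_nth 1 n"
      unfolding conv by simp
  qed
qed

lemma sym_series_sum:
  fixes X :: "('g, 'b) gset" and Y :: "('g, 'c) gset"
  assumes "fin_gset G X" "fin_gset G Y"
  shows "chi_fps H (sym_series (gset_sum X Y)) = chi_fps H (sym_series X) * chi_fps H (sym_series Y)"
proof -
  \<comment> \<open>\<open>gset_sum\<close> restricts its action to the carrier, which makes no
    difference to multisets supported there.\<close>
  have "image_mset (restrict f C) M = image_mset f M" if "set_mset M \<subseteq> C"
    for f :: "'b + 'c \<Rightarrow> 'b + 'c" and C M
    by (rule image_mset_cong) (use that in auto)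
  then have "inv_msets J (\<lambda>g. restrict (f g) C) C n = inv_msets J f C n"
    for f :: "'g \<Rightarrow> 'b + 'c \<Rightarrow> 'b + 'c" and J C n
    unfolding inv_msets_def by (intro Collect_cong conj_cong refl ball_cong) simp
  moreover have "fst (gset_sum X Y) = fst X <+> fst Y"
    "snd (gset_sum X Y) = (\<lambda>g. restrict (map_sum (snd X g) (snd Y g)) (fst X <+> fst Y))"
    by (simp_all add: gset_sum_def)
  ultimately show ?thesis
    using assms
    by (simp add: fps_eq_iff fps_mult_nth chi_fps_def chi_sym_series fin_gset_sum
        card_inv_msets_sum fin_gset_finite atLeast0AtMost)
qed

lemma sym_series_cong:
  assumes "fin_gset G X" "fin_gset G Y" "gset_iso G X Y"
  shows "sym_series X = sym_series Y"
proof -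
  have le: "card (inv_msets (H \<inter> carrier G) (snd X) (fst X) n)
      \<le> card (inv_msets (H \<inter> carrier G) (snd Y) (fst Y) n)"
    if Y: "fin_gset G Y" and iso: "gset_iso G X Y"
    for X :: "('g, 'd) gset" and Y :: "('g, 'e) gset" and H n
  proof -
    obtain f where "bij_betw f (fst X) (fst Y)"
      "\<And>g x. g \<in> carrier G \<Longrightarrow> x \<in> fst X \<Longrightarrow> f (snd X g x) = snd Y g (f x)"
      using iso by (auto simp: gset_iso_def)
    then show ?thesis
      using fin_gset_finite[OF Y] by (intro card_inv_msets_le[of _ f]) (auto simp: bij_betw_def)
  qed
  have "chi (sym_series X n) H = chi (sym_series Y n) H" for n H
    using le[OF assms(2,3)] le[OF assms(1) gset_iso_sym[OF assms(1,3)]]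
    by (simp add: chi_sym_series assms antisym)
  then show ?thesis
    using sym_series_closed[OF assms(1)] sym_series_closed[OF assms(2)]
    by (intro ext chi_inject) (auto simp: PS_carrier_iff)
qed

section \<open>Existence and uniqueness of the sigma-structure\<close>

definition is_sigma :: "('g burnside \<Rightarrow> nat \<Rightarrow> 'g burnside) \<Rightarrow> bool" where
  "is_sigma s \<longleftrightarrow> s \<in> carrier BR \<rightarrow>\<^sub>E carrier PS \<and>
     (\<forall>X :: ('g, nat) gset. fin_gset G X \<longrightarrow> (\<forall>n. s (gclass G X) n = gclass G (sym_power n X))) \<and>
     (\<forall>x \<in> carrier BR. \<forall>y \<in> carrier BR. s (x \<oplus>\<^bsub>BR\<^esub> y) = s x \<otimes>\<^bsub>PS\<^esub> s y)"

lemma chi_gdiff: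
  assumes "fin_gset G X" "fin_gset G Y"
  shows "gdiff G X Y \<in> carrier BR" "chi (gdiff G X Y) H = mark G X H - mark G Y H"
  using assms by (auto simp: gdiff_eq_mark_class carrier_BR virtual_diff chi_mark_class)

lemma carrier_BRE:
  assumes "x \<in> carrier BR"
  obtains X Y :: "('g, nat) gset" where "fin_gset G X" "fin_gset G Y" "x = gdiff G X Y"
  using assms by (auto simp: burnside_ring_def)

definition sigma_rep :: "'g burnside \<Rightarrow> ('g, nat) gset \<times> ('g, nat) gset" where
  "sigma_rep x = (SOME (X, Y). fin_gset G X \<and> fin_gset G Y \<and> x = gdiff G X Y)"

text \<open>Multiplying by \<open>tuple_series\<close> is division by sigma_t of the second set,
  carried out inside the Burnside ring. The restriction to the carrier makes the function
  extensional, as the definite description requires.\<close>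

definition sigma :: "'g burnside \<Rightarrow> nat \<Rightarrow> 'g burnside" where
  "sigma = (\<lambda>x \<in> carrier BR.
     sym_series (fst (sigma_rep x)) \<otimes>\<^bsub>PS\<^esub> tuple_series (snd (sigma_rep x)))"

lemma sigma_rep:
  assumes "x \<in> carrier BR"
  shows "fin_gset G (fst (sigma_rep x))" "fin_gset G (snd (sigma_rep x))"
    "x = gdiff G (fst (sigma_rep x)) (snd (sigma_rep x))"
proof -
  have "\<exists>p :: ('g, nat) gset \<times> ('g, nat) gset.
      case p of (X, Y) \<Rightarrow> fin_gset G X \<and> fin_gset G Y \<and> x = gdiff G X Y"
    using assms by (auto elim!: carrier_BRE)
  from someI_ex[OF this] show "fin_gset G (fst (sigma_rep x))" "fin_gset G (snd (sigma_rep x))"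
    "x = gdiff G (fst (sigma_rep x)) (snd (sigma_rep x))"
    unfolding sigma_rep_def by (simp_all add: case_prod_unfold)
qed

lemma sigma_closed: "x \<in> carrier BR \<Longrightarrow> sigma x \<in> carrier PS"
  by (simp add: sigma_def PS_mult_closed sym_series_closed tuple_series_closed sigma_rep)

lemma chi_fps_sigma_rep:
  assumes "x \<in> carrier BR"
  shows "chi_fps H (sigma x) * chi_fps H (sym_series (snd (sigma_rep x)))
    = chi_fps H (sym_series (fst (sigma_rep x)))"
  using sym_series_mult_tuple_series[OF sigma_rep(2)[OF assms], of H] assms
  by (simp add: sigma_def chi_fps_mult sym_series_closed tuple_series_closed sigma_rep mult.assoc
      mult.commute[of "chi_fps H (tuple_series _)"])

lemma sym_series_mark_cong:
  assumes "fin_gset G X" "fin_gset G Y" "\<And>H. mark G X H = mark G Y H"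
  shows "sym_series X = sym_series Y"
  using assms by (intro sym_series_cong gset_iso_if_mark_eq)

lemma chi_fps_sym_series_nonzero: "fin_gset G X \<Longrightarrow> chi_fps H (sym_series X) \<noteq> 0"
  using sym_series_mult_tuple_series[of X H] by auto

text \<open>Independence of the chosen pair (X', Y'): the sums X + Y' and X' + Y have the same
  marks, hence the same series, and the series of Y' is cancelled.\<close>

lemma chi_fps_sigma:
  assumes x: "x \<in> carrier BR" and X: "fin_gset G X" and Y: "fin_gset G Y"
    and eq: "\<And>H. chi x H = mark G X H - mark G Y H"
  shows "chi_fps H (sigma x) * chi_fps H (sym_series Y) = chi_fps H (sym_series X)"
proof -
  let ?X = "fst (sigma_rep x)" and ?Y = "snd (sigma_rep x)"
  note rep = sigma_rep[OF x]
  have marks: "mark G ?X H - mark G ?Y H = mark G X H - mark G Y H" for H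
    using chi_gdiff(2)[OF rep(1,2), of H] eq[of H] by (simp flip: rep(3))
  have "sym_series (gset_sum X ?Y) = sym_series (gset_sum ?X Y)"
  proof (rule sym_series_mark_cong)
    show "mark G (gset_sum X ?Y) H = mark G (gset_sum ?X Y) H" for H
      using marks[of H] X Y rep by (simp add: mark_sum)
  qed (simp_all add: fin_gset_sum X Y rep(1,2))
  then have "chi_fps H (sym_series X) * chi_fps H (sym_series ?Y)
      = chi_fps H (sym_series ?X) * chi_fps H (sym_series Y)"
    using X Y rep(1,2) by (simp flip: sym_series_sum)
  also have "\<dots> = chi_fps H (sigma x) * chi_fps H (sym_series Y) * chi_fps H (sym_series ?Y)"
    by (simp add: mult_ac flip: chi_fps_sigma_rep[OF x])
  finally show ?thesis
    using chi_fps_sym_series_nonzero[OF rep(2)] by simp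
qed

lemma sigma_gclass:
  assumes "fin_gset G X"
  shows "sigma (gclass G X) = sym_series X"
proof (rule chi_fps_inject)
  fix H
  \<comment> \<open>Writing [X] as [X + X + X] - [X + X] leaves a nonzero factor to cancel and
    avoids computing the series of the empty set.\<close>
  have "chi_fps H (sigma (gclass G X)) * chi_fps H (sym_series (gset_sum X X))
      = chi_fps H (sym_series (gset_sum X (gset_sum X X)))"
    using assms
    by (intro chi_fps_sigma gclass_closed fin_gset_sum) (simp_all add: chi_gclass mark_sum fin_gset_sum)
  then show "chi_fps H (sigma (gclass G X)) = chi_fps H (sym_series X)"
    using assms chi_fps_sym_series_nonzero[of "gset_sum X X" H]
    by (simp add: sym_series_sum fin_gset_sum)
qed (simp_all add: sigma_closed gclass_closed sym_series_closed assms)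

text \<open>The sums of the chosen sets represent x + y, and \<open>chi_fps_sigma\<close> accepts
  any representing pair.\<close>

lemma sigma_add:
  assumes x: "x \<in> carrier BR" and y: "y \<in> carrier BR"
  shows "sigma (x \<oplus>\<^bsub>BR\<^esub> y) = sigma x \<otimes>\<^bsub>PS\<^esub> sigma y"
proof (rule chi_fps_inject)
  fix H
  let ?X = "fst (sigma_rep x)" and ?Y = "snd (sigma_rep x)"
  let ?X' = "fst (sigma_rep y)" and ?Y' = "snd (sigma_rep y)"
  note rx = sigma_rep[OF x] and ry = sigma_rep[OF y]
  have "chi x H = mark G ?X H - mark G ?Y H" "chi y H = mark G ?X' H - mark G ?Y' H" for H
    using chi_gdiff(2)[OF rx(1,2), of H] chi_gdiff(2)[OF ry(1,2), of H] by (simp_all flip: rx(3) ry(3))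
  then have "chi_fps H (sigma (x \<oplus>\<^bsub>BR\<^esub> y)) * chi_fps H (sym_series (gset_sum ?Y ?Y'))
      = chi_fps H (sym_series (gset_sum ?X ?X'))"
    by (intro chi_fps_sigma) (simp_all add: x y chi_add mark_sum fin_gset_sum rx(1,2) ry(1,2))
  also have "\<dots> = chi_fps H (sigma x) * chi_fps H (sigma y) * chi_fps H (sym_series (gset_sum ?Y ?Y'))"
    by (simp add: sym_series_sum rx(1,2) ry(1,2) mult_ac flip: chi_fps_sigma_rep[OF x]
        chi_fps_sigma_rep[OF y])
  finally show "chi_fps H (sigma (x \<oplus>\<^bsub>BR\<^esub> y)) = chi_fps H (sigma x \<otimes>\<^bsub>PS\<^esub> sigma y)"
    using chi_fps_sym_series_nonzero[of "gset_sum ?Y ?Y'" H]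
    by (simp add: chi_fps_mult sigma_closed x y fin_gset_sum rx(1,2) ry(1,2))
qed (simp_all add: sigma_closed PS_mult_closed x y)

lemma is_sigma_sigma: "is_sigma sigma"
  unfolding is_sigma_def
  by (auto simp: sigma_closed sigma_gclass sigma_add sym_series_def PiE_iff)
    (simp add: sigma_def)

text \<open>Additivity applied to [X] = x + [Y] gives an equation whose only unknown is
  \<open>s x\<close>, and sigma_t(Y) is cancelled at each mark.\<close>

lemma is_sigma_unique:
  assumes "is_sigma s"
  shows "s = sigma"
proof (rule extensionalityI[of _ "carrier BR"])
  show "s \<in> extensional (carrier BR)" "sigma \<in> extensional (carrier BR)"
    using assms is_sigma_sigma by (auto simp: is_sigma_def PiE_iff)
  fix x assume x: "x \<in> carrier BR"
  then obtain X Y :: "('g, nat) gset"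
    where X: "fin_gset G X" and Y: "fin_gset G Y" and xXY: "x = gdiff G X Y"
    by (rule carrier_BRE)
  have sY: "s (gclass G Z) = sym_series Z" if "fin_gset G Z" for Z :: "('g, nat) gset"
    using assms that unfolding is_sigma_def by (intro ext) (simp only: sym_series_def)
  have sx: "s x \<in> carrier PS"
    using assms x by (auto simp: is_sigma_def)
  have "x \<oplus>\<^bsub>BR\<^esub> gclass G Y = gclass G X"
    using x X Y by (intro chi_inject) (auto simp: gclass_closed chi_add chi_gclass xXY chi_gdiff)
  then have "sym_series X = s x \<otimes>\<^bsub>PS\<^esub> sym_series Y"
    using assms x gclass_closed[OF Y] sY[OF X] sY[OF Y] unfolding is_sigma_def by metis
  then have "chi_fps H (s x) * chi_fps H (sym_series Y) = chi_fps H (sigma x) * chi_fps H (sym_series Y)"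
    for H
    using chi_fps_sigma[OF x X Y, of H] sx Y
    by (auto simp: chi_fps_mult sym_series_closed xXY chi_gdiff X)
  then show "s x = sigma x"
    using chi_fps_sym_series_nonzero[OF Y] by (intro chi_fps_inject sx sigma_closed x) simp
qed

lemma burnside_sigma_eq: "burnside_sigma G = sigma"
  unfolding burnside_sigma_def is_sigma_def[symmetric]
  by (rule the_equality[where P = is_sigma]) (rule is_sigma_sigma is_sigma_unique, assumption?)+

text \<open>The description of sigma prescribes values only for carriers of natural numbers; an
  isomorphic copy extends them to all types.\<close>

lemma burnside_sigma_gclass:
  fixes X :: "('g, 'b) gset"
  assumes "fin_gset G X"
  shows "burnside_sigma G (gclass G X) = sym_series X"
proof -
  obtain X' :: "('g, nat) gset" where X': "fin_gset G X'" "gset_iso G X X'"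
    using ex_nat_copy[OF assms] .
  have "gclass G X = gclass G X'"
    by (simp add: gclass_eq_mark_class assms X'(1) mark_cong[OF assms X'(2)])
  then show ?thesis
    by (simp add: burnside_sigma_eq sigma_gclass X'(1) sym_series_cong[OF assms X'])
qed

section \<open>Lambda operations of a finite G-set\<close>

theorem burnside_lambda_gclass:
  assumes "fin_gset G X"
  shows "burnside_lambda G (gclass G X) = subst_neg BR (tuple_series X)"
  unfolding burnside_lambda_def burnside_sigma_gclass[OF assms]
proof (rule the_equality)
  note closed = sym_series_closed[OF assms] tuple_series_closed[OF assms]
  show "subst_neg BR (tuple_series X) \<in> carrier PS \<and>
    sym_series X \<otimes>\<^bsub>PS\<^esub> subst_neg BR (subst_neg BR (tuple_series X)) = \<one>\<^bsub>PS\<^esub>"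
    using assms
    by (auto simp: subst_neg_subst_neg subst_neg_closed closed PS_mult_closed PS_one_closed chi_fps_mult
        chi_fps_one sym_series_mult_tuple_series intro!: chi_fps_inject)
  \<comment> \<open>Cancelling sigma_t(X), which is nonzero at every mark, determines
    \<open>subst_neg BR l\<close>; a second \<open>subst_neg\<close> then gives
    \<open>l\<close>.\<close>
  fix l assume l: "l \<in> carrier PS \<and> sym_series X \<otimes>\<^bsub>PS\<^esub> subst_neg BR l = \<one>\<^bsub>PS\<^esub>"
  have "chi_fps H (sym_series X) * chi_fps H (subst_neg BR l)
      = chi_fps H (sym_series X) * chi_fps H (tuple_series X)" for H
    using l closed by (simp add: subst_neg_closed sym_series_mult_tuple_series[OF assms] chi_fps_one
        flip: chi_fps_mult)
  then have "subst_neg BR l = tuple_series X"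
    using l closed chi_fps_sym_series_nonzero[OF assms]
    by (intro chi_fps_inject) (auto simp: subst_neg_closed)
  then show "l = subst_neg BR (tuple_series X)"
    using l subst_neg_subst_neg by metis
qed

text \<open>Disjoint blocks inside X have total size at most that of X, so no list is left to count
  and the marks vanish for every \<open>H\<close>.\<close>

lemma tuple_series_eq_zero:
  assumes "fin_gset G X" "card (fst X) < n"
  shows "tuple_series X n = \<zero>\<^bsub>BR\<^esub>"
proof (rule chi_inject)
  fix H
  have "sum_list (map card Ts) = card (\<Union>(set Ts))"
    if "sorted_wrt (\<lambda>S T. S \<inter> T = {}) Ts" "\<forall>T \<in> set Ts. finite T" for Ts :: "'a set list"
    using that
  proof (induction Ts)
    case (Cons T Ts)
    then show ?case
      by (simp, subst card_Un_disjoint) auto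
  qed simp
  moreover have "card (\<Union>(set Ts)) \<le> card (fst X)" if "\<forall>T \<in> set Ts. T \<subseteq> fst X" for Ts
    using that by (intro card_mono fin_gset_finite assms(1)) auto
  ultimately have "inv_set_lists J a (fst X) n = {}" for J :: "'g set" and a
    using assms(2) finite_subset[OF _ fin_gset_finite[OF assms(1)]]
    unfolding inv_set_lists_def by fastforce
  then show "chi (tuple_series X n) H = chi \<zero>\<^bsub>BR\<^esub> H"
    by (simp add: chi_tuple_series assms(1) signed_count_def chi_zero)
qed (use tuple_series_closed[OF assms(1)] in \<open>auto simp: PS_carrier_iff\<close>)

end

theorem mainTheorem1:
  fixes G :: "('g, 'm) monoid_scheme"
    and S :: "'s set" and \<phi> :: "'g \<Rightarrow> 's \<Rightarrow> 's" and i :: nat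
  assumes "group G" and "finite (carrier G)"
    and "group_action G S \<phi>" and "finite S"
    and "0 < i"
  shows "(i \<le> card S \<longrightarrow>
           burnside_lambda G (gclass G (S, \<phi>)) i =
             [((-1) ^ i :: int)] \<cdot>\<^bsub>burnside_ring G\<^esub>
               (\<Oplus>\<^bsub>burnside_ring G\<^esub> \<mu> \<in> partitions i.
                  [((-1) ^ length \<mu> * int (multinomial (length \<mu>) (multiplicities \<mu>)))]
                    \<cdot>\<^bsub>burnside_ring G\<^esub> gclass G (gset_tuples \<mu> (S, \<phi>)))) \<and>
         (card S < i \<longrightarrow> burnside_lambda G (gclass G (S, \<phi>)) i = \<zero>\<^bsub>burnside_ring G\<^esub>)"
proof -
  interpret burnside_group G
    using assms(1,2) by (simp add: burnside_group_def burnside_group_axioms_def)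
  interpret BR: cring "burnside_ring G"
    by (rule cring_BR)
  have fin: "fin_gset G (S, \<phi>)"
    using assms(3,4) by (simp add: fin_gset_def)
  have "burnside_lambda G (gclass G (S, \<phi>)) i
      = [((-1) ^ i :: int)] \<cdot>\<^bsub>burnside_ring G\<^esub> tuple_series (S, \<phi>) i"
    by (simp add: burnside_lambda_gclass[OF fin] subst_neg_def)
  moreover have "tuple_series (S, \<phi>) i = \<zero>\<^bsub>burnside_ring G\<^esub>" if "card S < i"
    using tuple_series_eq_zero[OF fin] that by simp
  ultimately show ?thesis
    by (simp add: tuple_series_def BR.add.int_pow_one)
qed

end
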